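(* Let $A, B, C, D:\Omega_+\to\mathbb{R}$ be continuous functions such that $$A(u)+B(v)=C\left(\mathbb{P}\big((\mathbf{e}+u)^{-1/2}\big)v\right)+D\left(\mathbb{P}\Big(\big[\mathbf{e}+\mathbb{P}\big((\mathbf{e}+u)^{-1/2}\big)v\big]^{1/2}\Big)u\right)$$ for any $u,v\in\Omega_+$. Then there exist constants $a,b,c_1,c_2,d\in\mathbb{R}$ and $\lambda>0$ such that for all $x\in\Omega_+$ $$\begin{aligned} A(x)&=a\log\det x-b\log\det(\mathbf{e}+x)+c_1+\lambda\,\mathrm{tr}\,x,\\ B(x)&=b\log\det x+c_2+d+\lambda\,\mathrm{tr}\,x,\\ C(x)&=b\log\det x-a\log\det(\mathbf{e}+x)+c_2+\lambda\,\mathrm{tr}\,x,\\ D(x)&=a\log\det x+c_1+d+\lambda\,\mathrm{tr}\,x. \end{aligned}$$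
   Context: Let $r\ge 1$ be an integer. $\Omega$ is the linear space of real symmetric $r\times r$ matrices, $\Omega_+\subset\Omega$ is the cone of positive definite matrices, and $\mathbf{e}$ is the $r\times r$ identity matrix. For $y\in\Omega_+$, $\mathbb{P}(y)$ is the endomorphism of $\Omega$ given by $\mathbb{P}(y)x=yxy$. For $y\in\Omega_+$, $y^{1/2}\in\Omega_+$ is the positive definite square root and $y^{-1/2}=(y^{1/2})^{-1}$.
   Formalization: The condition λ > 0 is replaced by λ ∈ ℝ, since the printed claim fails: A = B = C = D = 0 satisfies all hypotheses but forces λ = 0 (and A = B = C = D = −tr forces λ = −1). *)

theory Defs
  imports "HOL-Analysis.Analysis"
begin

definition sym_matrices :: "(real ^ 'n ^ 'n) set" where
  "sym_matrices = {x. transpose x = x}"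

definition posdef_cone :: "(real ^ 'n ^ 'n) set" where
  "posdef_cone = {x \<in> sym_matrices. \<forall>h. h \<noteq> 0 \<longrightarrow> 0 < h \<bullet> (x *v h)}"

text \<open>Only meaningful for positive definite \<open>y\<close>, where the positive definite root exists
  and is unique.\<close>

definition msqrt :: "real ^ 'n ^ 'n \<Rightarrow> real ^ 'n ^ 'n" where
  "msqrt y = (THE s. s \<in> posdef_cone \<and> s ** s = y)"

definition quad_rep :: "real ^ 'n ^ 'n \<Rightarrow> real ^ 'n ^ 'n \<Rightarrow> real ^ 'n ^ 'n" where
  "quad_rep y x = y ** x ** y"

end

theory Submission
  imports Defs
begin

text \<open>
  Parametrising \<open>u = w\<^sup>2 - e\<close> and \<open>w\<^sup>-\<^sup>1 v w\<^sup>-\<^sup>1 = m\<^sup>2 - e\<close> turns the equation into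
  \<open>A(w\<^sup>2 - e) + B(w (m\<^sup>2 - e) w) = C(m\<^sup>2 - e) + D(m (w\<^sup>2 - e) m)\<close>, which is symmetric under
  exchanging \<open>(A, B)\<close> with \<open>(C, D)\<close>. Letting \<open>u\<close> tend to \<open>0\<close> shows that \<open>D(s u s) - D(u)\<close> has a
  limit \<open>G(s)\<close> with \<open>G(s t s) = 2 G(s) + G(t)\<close>; hence \<open>G\<close> is a multiple of \<open>ln det\<close>, so
  \<open>B(x) - C(x)\<close>, and by symmetry \<open>D(x) - A(x)\<close>, is affine in \<open>ln det(e + x)\<close>. Subtracting the
  logarithmic solution leaves an equation in only two functions \<open>p\<close> and \<open>q\<close>. With
  \<open>u = t e\<close>, \<open>x = z / t\<close> and \<open>t\<close> tending to infinity, both change by a multiple of \<open>h\<close> under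
  translation by \<open>h e\<close>, and they differ by a constant. After removing a multiple of the trace,
  scaling limits show that the remaining function \<open>\<phi>\<close> is homogeneous, additive and satisfies
  \<open>\<phi>(s t\<^sup>2 s) = \<phi>(t s\<^sup>2 t)\<close>, so it is a multiple of the trace, and it vanishes because
  \<open>\<phi>(e) = 0\<close>.
\<close>

text \<open>Through the interpretation \<open>mm\<close> this supplies the distributivity, scaling
  and limit rules for matrix products used throughout.\<close>

lemma bounded_bilinear_matrix_mul:
  "bounded_bilinear ((**) :: real ^ 'n ^ 'm \<Rightarrow> real ^ 'p ^ 'n \<Rightarrow> real ^ 'p ^ 'm)"
  unfolding bilinear_conv_bounded_bilinear[symmetric]
  by (auto simp: bilinear_def linear_iff vec_eq_iff matrix_matrix_mult_def algebra_simps sum.distrib sum_distrib_left)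

interpretation mm: bounded_bilinear
  "(**) :: real ^ 'n ^ 'm \<Rightarrow> real ^ 'p ^ 'n \<Rightarrow> real ^ 'p ^ 'm"
  by (rule bounded_bilinear_matrix_mul)

section \<open>Diagonalisation of symmetric matrices\<close>

lemma dot_matrix_mul_transpose:
  fixes x :: "real ^ 'n ^ 'm"
  shows "h \<bullet> (x *v l) = (transpose x *v h) \<bullet> l"
  by (metis dot_lmul_matrix transpose_matrix_vector)

text \<open>The form \<open>x \<bullet> f x\<close> attains its maximum \<open>M\<close> over the
  unit sphere of \<open>S\<close> at some \<open>h\<close>. Then
  \<open>M * (v \<bullet> v) - v \<bullet> f v\<close> is nonnegative on \<open>S\<close> and zero
  at \<open>h\<close>, so its first-order term \<open>- 2 * t * (y \<bullet> y)\<close> in the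
  direction \<open>y = f h - M *\<^sub>R h\<close> must vanish.\<close>

lemma Rayleigh_max_eigenvector:
  fixes f :: "'a::euclidean_space \<Rightarrow> 'a"
  assumes f: "linear f" and sa: "\<And>x y. x \<bullet> f y = f x \<bullet> y"
    and S: "subspace S" "f ` S \<subseteq> S" "S \<noteq> {0}"
  obtains h \<mu> where "h \<in> S" "norm h = 1" "f h = \<mu> *\<^sub>R h"
proof -
  interpret linear f by fact
  obtain s where s: "s \<in> S" "s \<noteq> 0" using S subspace_0 by blast
  have comp: "compact (S \<inter> sphere 0 1)"
    by (intro closed_Int_compact closed_subspace S compact_sphere)
  have "s /\<^sub>R norm s \<in> S \<inter> sphere 0 1"
    using s S by (auto simp: subspace_scale)
  moreover have "continuous_on (S \<inter> sphere 0 1) (\<lambda>x. x \<bullet> f x)"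
    by (intro continuous_intros linear_continuous_on) (simp add: f linear_conv_bounded_linear[symmetric])
  ultimately obtain h where h: "h \<in> S" "norm h = 1"
    and max: "\<And>y. y \<in> S \<Longrightarrow> norm y = 1 \<Longrightarrow> y \<bullet> f y \<le> h \<bullet> f h"
    using continuous_attains_sup[OF comp, of "\<lambda>x. x \<bullet> f x"] by (metis IntE IntI empty_iff mem_sphere_0)
  define M where "M = h \<bullet> f h"
  define q where "q v = M * (v \<bullet> v) - v \<bullet> f v" for v
  have q0: "q v \<ge> 0" if "v \<in> S" for v
  proof (cases "v = 0")
    case False
    then have "(v /\<^sub>R norm v) \<bullet> f (v /\<^sub>R norm v) \<le> M"
      unfolding M_def using that S by (intro max) (auto simp: subspace_scale)
    then have "(v \<bullet> f v) / (norm v)\<^sup>2 \<le> M"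
      by (simp add: scale power2_eq_square divide_inverse mult.commute mult.left_commute)
    then show ?thesis
      using False by (simp add: q_def divide_le_eq power2_norm_eq_inner)
  qed (simp add: q_def)
  define y where "y = f h - M *\<^sub>R h"
  have yS: "y \<in> S" unfolding y_def using S h by (auto intro!: subspace_diff subspace_scale)
  have expand: "q (h + t *\<^sub>R y) = - 2 * t * (y \<bullet> y) + t\<^sup>2 * q y" for t
  proof -
    have fe: "f (h + t *\<^sub>R y) = f h + t *\<^sub>R f y" by (simp add: add scale)
    have 1: "h \<bullet> f y = f h \<bullet> y" "y \<bullet> f h = f h \<bullet> y" "y \<bullet> h = h \<bullet> y"
      using sa by (auto simp: inner_commute)
    have "q (h + t *\<^sub>R y) = q h + 2 * t * (M * (h \<bullet> y) - f h \<bullet> y) + t\<^sup>2 * q y"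
      unfolding q_def fe inner_add_left inner_add_right inner_scaleR_left inner_scaleR_right 1
      by algebra
    moreover have "q h = 0" using h by (simp add: q_def M_def norm_eq_1)
    moreover have "M * (h \<bullet> y) - f h \<bullet> y = - (y \<bullet> y)"
      by (simp add: y_def inner_diff_left inner_diff_right inner_commute[of "f h" h] algebra_simps)
    ultimately show ?thesis by simp
  qed
  have "y = 0"
  proof (rule ccontr)
    assume "y \<noteq> 0"
    then have yy: "y \<bullet> y > 0" by simp
    \<comment> \<open>With this \<open>t\<close> the quadratic term is at most
      \<open>t * (y \<bullet> y)\<close>, half the size of the linear one. The summand 1 keeps the
      denominator positive when \<open>q y = 0\<close>.\<close>
    define t where "t = (y \<bullet> y) / (1 + q y)"
    have qy: "q y \<ge> 0" using q0 yS by blast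
    then have t: "t > 0" using yy by (simp add: t_def)
    have "t * q y \<le> y \<bullet> y"
      using qy yy by (simp add: t_def field_simps)
    then have "t * (t * q y) \<le> t * (y \<bullet> y)" using t by simp
    moreover have "0 \<le> - 2 * t * (y \<bullet> y) + t\<^sup>2 * q y"
      using q0[of "h + t *\<^sub>R y"] h yS S expand by (simp add: subspace_add subspace_scale)
    ultimately have "t * (y \<bullet> y) \<le> 0" by (simp add: power2_eq_square algebra_simps)
    then show False using t yy by (simp add: mult_le_0_iff)
  qed
  then have "f h = M *\<^sub>R h" by (simp add: y_def)
  with h that show ?thesis by blast
qed

text \<open>An orthonormal set of eigenvectors of largest size spans: by self-adjointness its
  orthogonal complement is invariant under \<open>f\<close>, so a nonzero complement would contain
  one more unit eigenvector.\<close>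

lemma self_adjoint_eigenbasis:
  fixes f :: "'a::euclidean_space \<Rightarrow> 'a"
  assumes f: "linear f" and sa: "\<And>x y. x \<bullet> f y = f x \<bullet> y"
  obtains E where "pairwise orthogonal E" "card E = DIM('a)" "finite E"
    "\<And>h. h \<in> E \<Longrightarrow> norm h = 1" "\<And>h. h \<in> E \<Longrightarrow> \<exists>\<mu>. f h = \<mu> *\<^sub>R h"
proof -
  interpret linear f by fact
  define P where "P E \<longleftrightarrow> pairwise orthogonal E \<and> (\<forall>h\<in>E. norm h = 1 \<and> (\<exists>\<mu>. f h = \<mu> *\<^sub>R h))" for E
  have indep: "independent E" if "P E" for E
    using that by (intro pairwise_orthogonal_independent) (auto simp: P_def)
  have bound: "card E \<le> DIM('a)" if "P E" for E
    using indep[OF that] independent_bound by blast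
  have "P {}" by (simp add: P_def)
  then obtain E where E: "P E" and max: "\<And>E'. P E' \<Longrightarrow> card E' \<le> card E"
    using ex_has_greatest_nat[of P "{}" card "Suc (DIM('a))"] bound by (metis less_Suc_eq_le)
  have fin: "finite E" using indep[OF E] independent_bound by blast
  define S where "S = {y. \<forall>h\<in>E. orthogonal y h}"
  have sub: "subspace S"
    by (auto simp: subspace_def S_def orthogonal_clauses)
  have inv: "f ` S \<subseteq> S"
  proof clarify
    fix y assume y: "y \<in> S"
    have "f y \<bullet> h = 0" if "h \<in> E" for h
    proof -
      obtain \<mu> where "f h = \<mu> *\<^sub>R h" using E \<open>h \<in> E\<close> by (auto simp: P_def)
      then show ?thesis using sa[of y h] y that by (simp add: S_def orthogonal_def)
    qed
    then show "f y \<in> S" by (simp add: S_def orthogonal_def)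
  qed
  have "S = {0}"
  proof (rule ccontr)
    assume "S \<noteq> {0}"
    then obtain h \<mu> where h: "h \<in> S" "norm h = 1" "f h = \<mu> *\<^sub>R h"
      using Rayleigh_max_eigenvector[OF f sa sub inv] by blast
    have "h \<notin> E" using h by (auto simp: S_def orthogonal_def)
    moreover have "P (insert h E)"
      using E h by (auto simp: P_def S_def pairwise_insert orthogonal_commute)
    ultimately show False using max[of "insert h E"] fin by simp
  qed
  have "card E = DIM('a)"
  proof -
    have "span E = UNIV"
    proof -
      have "x \<in> span E" for x
      proof -
        obtain y z where yz: "y \<in> span E" "\<And>w. w \<in> span E \<Longrightarrow> orthogonal z w" "x = y + z"
          using orthogonal_subspace_decomp_exists[of E x] by blast
        then have "z \<in> S" by (auto simp: S_def span_base)
        then show ?thesis using yz \<open>S = {0}\<close> by simp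
      qed
      then show ?thesis by blast
    qed
    then show ?thesis using dim_eq_card_independent[OF indep[OF E]] dim_span[of E] by simp
  qed
  with E fin that show ?thesis by (auto simp: P_def)
qed

section \<open>Diagonal matrices and the spectral theorem\<close>

definition diagm :: "('n \<Rightarrow> real) \<Rightarrow> real ^ 'n ^ 'n" where
  "diagm f = (\<chi> i j. if i = j then f i else 0)"

lemma diagm_nth [simp]: "diagm f $ i $ j = (if i = j then f i else 0)"
  by (simp add: diagm_def)

lemma diagm_mul_nth: "(diagm f ** x) $ i $ j = f i * x $ i $ j"
proof -
  have "(diagm f ** x) $ i $ j = (\<Sum>k\<in>UNIV. if k = i then f i * x $ i $ j else 0)"
    unfolding matrix_matrix_mult_def vec_lambda_beta by (rule sum.cong) auto
  then show ?thesis by simp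
qed

lemma mul_diagm_nth: "(x ** diagm f) $ i $ j = x $ i $ j * f j"
proof -
  have "(x ** diagm f) $ i $ j = (\<Sum>k\<in>UNIV. if k = j then x $ i $ j * f j else 0)"
    unfolding matrix_matrix_mult_def vec_lambda_beta by (rule sum.cong) auto
  then show ?thesis by simp
qed

lemma diagm_mult_vec_nth: "(diagm f *v h) $ i = f i * h $ i"
proof -
  have "(diagm f *v h) $ i = (\<Sum>k\<in>UNIV. if k = i then f i * h $ i else 0)"
    unfolding matrix_vector_mult_def vec_lambda_beta by (rule sum.cong) auto
  then show ?thesis by simp
qed

lemma diagm_mult [simp]: "diagm f ** diagm g = diagm (\<lambda>i. f i * g i)"
  by (simp add: vec_eq_iff diagm_mul_nth)

lemma transpose_diagm [simp]: "transpose (diagm f) = diagm f"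
  by (auto simp: vec_eq_iff transpose_def)

lemma diagm_one: "diagm (\<lambda>_. c) = c *\<^sub>R mat 1"
  by (auto simp: vec_eq_iff mat_def)

lemma det_diagm [simp]: "det (diagm f) = prod f UNIV"
  by (subst det_diagonal) auto

theorem symmetric_matrix_diagonalization:
  fixes x :: "real ^ 'n ^ 'n"
  assumes "x \<in> sym_matrices"
  obtains k f where "orthogonal_matrix k" "x = k ** diagm f ** transpose k"
proof -
  have sa: "h \<bullet> (x *v l) = (x *v h) \<bullet> l" for h l
    using assms dot_matrix_mul_transpose[of h x l] by (simp only: sym_matrices_def mem_Collect_eq)
  obtain E :: "(real ^ 'n) set" where E: "pairwise orthogonal E" "card E = CARD('n)" "finite E"
    "\<And>h. h \<in> E \<Longrightarrow> norm h = 1" "\<And>h. h \<in> E \<Longrightarrow> \<exists>\<mu>. x *v h = \<mu> *\<^sub>R h"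
    using self_adjoint_eigenbasis[of "(*v) x"] sa by (auto simp: matrix_vector_mul_linear)
  obtain b :: "'n \<Rightarrow> real ^ 'n" where b: "bij_betw b UNIV E"
    using E by (metis bij_betw_iff_card finite)
  have bE: "b i \<in> E" for i using b by (auto simp: bij_betw_def)
  obtain f where f: "\<And>i. x *v b i = f i *\<^sub>R b i"
    using E(5)[OF bE] by metis
  define k where "k = (\<chi> i j. b j $ i)"
  have col: "column i k = b i" for i by (simp add: k_def column_def vec_eq_iff)
  have orth: "b i \<bullet> b j = 0" if "i \<noteq> j" for i j
  proof -
    have "b i \<noteq> b j" using that b by (auto simp: bij_betw_def inj_def)
    then show ?thesis using E(1) bE by (auto simp: pairwise_def orthogonal_def)
  qed
  have ok: "orthogonal_matrix k"
    unfolding orthogonal_matrix_orthonormal_columns col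
    using E(4) bE orth by (auto simp: orthogonal_def)
  have "x ** k = k ** diagm f"
  proof -
    have "(x ** k) $ i $ j = (k ** diagm f) $ i $ j" for i j
    proof -
      have "(x ** k) $ i $ j = (x *v b j) $ i"
        by (simp add: k_def matrix_matrix_mult_def matrix_vector_mult_def)
      also have "\<dots> = (k ** diagm f) $ i $ j"
        unfolding f by (simp add: k_def mul_diagm_nth)
      finally show ?thesis .
    qed
    then show ?thesis by (simp add: vec_eq_iff)
  qed
  then have "x ** (k ** transpose k) = k ** diagm f ** transpose k"
    by (metis matrix_mul_assoc)
  then show ?thesis using ok that by (simp add: orthogonal_matrix_def)
qed

section \<open>The cone of positive definite matrices\<close>

lemma posdef_cone_iff:
  "x \<in> posdef_cone \<longleftrightarrow> transpose x = x \<and> (\<forall>h. h \<noteq> 0 \<longrightarrow> 0 < h \<bullet> (x *v h))"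
  by (simp add: posdef_cone_def sym_matrices_def)

lemma transpose_posdef: "x \<in> posdef_cone \<Longrightarrow> transpose x = x"
  by (simp add: posdef_cone_iff)

lemma posdef_pos: "x \<in> posdef_cone \<Longrightarrow> h \<noteq> 0 \<Longrightarrow> 0 < h \<bullet> (x *v h)"
  by (simp add: posdef_cone_iff)

lemma posdef_mat_1 [simp]: "mat 1 \<in> posdef_cone"
  by (simp add: posdef_cone_iff)

lemma transpose_add: "transpose (x + y) = transpose x + (transpose y :: real ^ 'n ^ 'm)"
  by (simp add: vec_eq_iff transpose_def)

lemma transpose_diff: "transpose (x - y) = transpose x - (transpose y :: real ^ 'n ^ 'm)"
  by (simp add: vec_eq_iff transpose_def)

lemma posdef_add [intro]: "x \<in> posdef_cone \<Longrightarrow> y \<in> posdef_cone \<Longrightarrow> x + y \<in> posdef_cone"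
  by (auto simp: posdef_cone_iff transpose_add matrix_vector_mult_add_rdistrib inner_add_right intro!: add_pos_pos)

lemma posdef_scaleR [intro]: "x \<in> posdef_cone \<Longrightarrow> 0 < t \<Longrightarrow> t *\<^sub>R x \<in> posdef_cone"
  by (simp add: posdef_cone_iff transpose_scalar scaleR_matrix_vector_assoc[symmetric])

text \<open>The quadratic form of \<open>g ** x ** transpose g\<close> at \<open>h\<close> is that
  of \<open>x\<close> at \<open>transpose g *v h\<close>, and \<open>transpose g\<close> has trivial
  kernel.\<close>

lemma posdef_congruence:
  fixes x g :: "real ^ 'n ^ 'n"
  assumes x: "x \<in> posdef_cone" and g: "invertible g"
  shows "g ** x ** transpose g \<in> posdef_cone"
proof -
  have "0 < h \<bullet> ((g ** x ** transpose g) *v h)" if "h \<noteq> 0" for h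
  proof -
    have "\<exists>B. B ** transpose g = mat 1"
      using transpose_invertible[OF g] by (auto simp: invertible_def)
    then have "transpose g *v h \<noteq> 0"
      using that matrix_left_invertible_ker[of "transpose g"] by blast
    then have "0 < (transpose g *v h) \<bullet> (x *v (transpose g *v h))"
      by (rule posdef_pos[OF x])
    also have "\<dots> = h \<bullet> (g *v (x *v (transpose g *v h)))"
      by (simp only: dot_matrix_mul_transpose[of h g])
    finally show ?thesis by (simp only: matrix_vector_mul_assoc matrix_mul_assoc)
  qed
  then show ?thesis using x
    by (simp add: posdef_cone_iff matrix_transpose_mul matrix_mul_assoc)
qed

lemma posdef_invertible: "x \<in> posdef_cone \<Longrightarrow> invertible x"
  unfolding invertible_left_inverse matrix_left_invertible_ker
  using posdef_pos[of x] by fastforce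

lemma posdef_quad: "s \<in> posdef_cone \<Longrightarrow> x \<in> posdef_cone \<Longrightarrow> s ** x ** s \<in> posdef_cone"
  by (metis posdef_congruence posdef_invertible transpose_posdef)

lemma posdef_square: "s \<in> posdef_cone \<Longrightarrow> s ** s \<in> posdef_cone"
  using posdef_quad[of s "mat 1"] by simp

lemma matrix_inv_inverse:
  assumes "invertible (x :: real ^ 'n ^ 'n)"
  shows "x ** matrix_inv x = mat 1" "matrix_inv x ** x = mat 1"
  using assms unfolding invertible_def matrix_inv_def by (metis (mono_tags, lifting) someI_ex)+

lemma posdef_inv:
  assumes "x \<in> posdef_cone"
  shows "matrix_inv x \<in> posdef_cone"
proof -
  note inv = matrix_inv_inverse[OF posdef_invertible[OF assms]]
  have t: "transpose (matrix_inv x) = matrix_inv x"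
    by (metis assms inv matrix_mul_assoc matrix_mul_lid matrix_mul_rid matrix_transpose_mul transpose_mat transpose_posdef)
  have "invertible (matrix_inv x)" using inv by (auto simp: invertible_def)
  from posdef_congruence[OF assms this] show ?thesis using t inv by simp
qed

lemma orthogonal_conjugate_cancel:
  fixes k x y :: "real ^ 'n ^ 'n"
  assumes "orthogonal_matrix k"
  shows "(k ** x ** transpose k) ** (k ** y ** transpose k) = k ** (x ** y) ** transpose k"
proof -
  have "(k ** x ** transpose k) ** (k ** y ** transpose k) = k ** x ** (transpose k ** k) ** y ** transpose k"
    by (simp only: matrix_mul_assoc)
  also have "\<dots> = k ** x ** y ** transpose k"
    using assms by (simp only: orthogonal_matrix matrix_mul_rid)
  finally show ?thesis by (simp only: matrix_mul_assoc)
qed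

lemma orthogonal_matrix_invertible: "orthogonal_matrix k \<Longrightarrow> invertible k"
  by (auto simp: orthogonal_matrix_def invertible_def)

lemma diagm_posdef_iff: "diagm f \<in> posdef_cone \<longleftrightarrow> (\<forall>i. f i > 0)"
proof -
  have q: "h \<bullet> (diagm f *v h) = (\<Sum>i\<in>UNIV. f i * (h $ i)\<^sup>2)" for h
    by (simp add: inner_vec_def diagm_mult_vec_nth power2_eq_square mult.left_commute)
  show ?thesis
  proof
    assume "diagm f \<in> posdef_cone"
    then have "0 < axis i 1 \<bullet> (diagm f *v axis i 1)" for i
      by (simp add: posdef_cone_iff axis_eq_0_iff)
    then have "0 < (\<Sum>j\<in>UNIV. f j * (axis i 1 $ j)\<^sup>2)" for i unfolding q .
    moreover have "(\<Sum>j\<in>UNIV. f j * (axis i 1 $ j)\<^sup>2) = (\<Sum>j\<in>UNIV. if j = i then f i else 0)" for i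
      unfolding axis_def vec_lambda_beta by (rule sum.cong) auto
    ultimately show "\<forall>i. f i > 0" by simp
  next
    assume f: "\<forall>i. f i > 0"
    have "0 < (\<Sum>i\<in>UNIV. f i * (h $ i)\<^sup>2)" if h: "h \<noteq> 0" for h :: "real ^ 'a"
    proof -
      obtain i where "h $ i \<noteq> 0" using h by (auto simp: vec_eq_iff)
      then show ?thesis using f
        by (intro sum_pos2[of _ i]) (auto simp: less_imp_le)
    qed
    then show "diagm f \<in> posdef_cone" unfolding posdef_cone_iff q by simp
  qed
qed

lemma posdef_diagonalization:
  assumes "x \<in> posdef_cone"
  obtains k f where "orthogonal_matrix k" "x = k ** diagm f ** transpose k" "\<And>i. f i > 0"
proof -
  obtain k f where k: "orthogonal_matrix k" "x = k ** diagm f ** transpose k"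
    using assms symmetric_matrix_diagonalization[of x] by (auto simp: posdef_cone_def)
  have kk: "transpose k ** k = mat 1" using k by (simp add: orthogonal_matrix)
  have "transpose k ** x ** transpose (transpose k) \<in> posdef_cone"
    using k by (intro posdef_congruence assms orthogonal_matrix_invertible) simp
  also have "transpose k ** x ** transpose (transpose k) = (transpose k ** k) ** diagm f ** (transpose k ** k)"
    unfolding k(2) by (simp only: matrix_mul_assoc transpose_transpose)
  finally have "diagm f \<in> posdef_cone" by (simp add: kk)
  with k that show ?thesis by (simp add: diagm_posdef_iff)
qed

section \<open>Square roots of positive definite matrices\<close>

lemma posdef_sqrt_exists:
  assumes "x \<in> posdef_cone"
  obtains s where "s \<in> posdef_cone" "s ** s = x"
proof -
  obtain k f where k: "orthogonal_matrix k" "x = k ** diagm f ** transpose k" "\<And>i. f i > 0"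
    using posdef_diagonalization[OF assms] by metis
  let ?s = "k ** diagm (\<lambda>i. sqrt (f i)) ** transpose k"
  have "?s \<in> posdef_cone"
    using k by (intro posdef_congruence orthogonal_matrix_invertible) (auto simp: diagm_posdef_iff)
  moreover have "?s ** ?s = x"
    unfolding orthogonal_conjugate_cancel[OF k(1)] using k by (simp add: less_imp_le)
  ultimately show ?thesis using that by blast
qed

text \<open>The identity \<open>s ** s - t ** t = s ** (s - t) + (s - t) ** t\<close> handles roots
  that are not known to commute. Its form at an eigenvector \<open>h\<close> of \<open>s - t\<close>
  is the eigenvalue times \<open>h \<bullet> (s *v h) + h \<bullet> (t *v h)\<close>, which is
  positive, so every eigenvalue of \<open>s - t\<close> is zero.\<close>

lemma posdef_sqrt_unique:
  assumes s: "s \<in> posdef_cone" and t: "t \<in> posdef_cone" and eq: "s ** s = t ** t"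
  shows "s = t"
proof -
  have sym: "transpose (s - t) = s - t"
    using s t by (simp add: transpose_diff transpose_posdef)
  obtain k f where k: "orthogonal_matrix k" "s - t = k ** diagm f ** transpose k"
    using sym symmetric_matrix_diagonalization[of "s - t"] by (auto simp: sym_matrices_def)
  have "f i = 0" for i
  proof -
    define h where "h = k *v axis i 1"
    have kk: "transpose k ** k = mat 1" using k by (simp add: orthogonal_matrix)
    have h0: "h \<noteq> 0"
    proof
      assume "h = 0"
      then have "(transpose k ** k) *v axis i 1 = 0"
        unfolding h_def by (simp add: matrix_vector_mul_assoc[symmetric])
      then show False by (simp add: kk axis_eq_0_iff)
    qed
    have "(s - t) *v h = (k ** diagm f ** (transpose k ** k)) *v axis i 1"
      unfolding k(2) h_def by (simp add: matrix_vector_mul_assoc matrix_mul_assoc)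
    also have "\<dots> = k *v (diagm f *v axis i 1)"
      by (simp add: kk matrix_vector_mul_assoc)
    also have "diagm f *v axis i 1 = f i *\<^sub>R axis i 1"
      by (simp add: vec_eq_iff diagm_mult_vec_nth axis_def)
    finally have eig: "(s - t) *v h = f i *\<^sub>R h"
      by (simp add: h_def matrix_vector_mult_scaleR)
    have "0 = h \<bullet> ((s ** s - t ** t) *v h)" by (simp add: eq)
    also have "s ** s - t ** t = s ** (s - t) + (s - t) ** t"
      by (simp add: mm.diff_left mm.diff_right)
    also have "h \<bullet> (\<dots> *v h) = h \<bullet> (s *v ((s - t) *v h)) + h \<bullet> ((s - t) *v (t *v h))"
      by (simp add: matrix_vector_mult_add_rdistrib matrix_vector_mul_assoc inner_add_right)
    also have "h \<bullet> ((s - t) *v (t *v h)) = ((s - t) *v h) \<bullet> (t *v h)"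
      by (simp only: dot_matrix_mul_transpose[of h "s - t"] sym)
    finally have "0 = h \<bullet> (s *v (f i *\<^sub>R h)) + (f i *\<^sub>R h) \<bullet> (t *v h)"
      unfolding eig .
    then have "f i * (h \<bullet> (s *v h) + h \<bullet> (t *v h)) = 0"
      by (simp add: matrix_vector_mult_scaleR distrib_left)
    moreover have "h \<bullet> (s *v h) > 0" "h \<bullet> (t *v h) > 0"
      using s t h0 by (auto simp: posdef_cone_iff)
    ultimately show ?thesis by simp
  qed
  then have "diagm f = 0" by (simp add: vec_eq_iff)
  then show ?thesis using k by simp
qed

lemma msqrt:
  assumes "x \<in> posdef_cone"
  shows msqrt_posdef: "msqrt x \<in> posdef_cone" and msqrt_square: "msqrt x ** msqrt x = x"
proof -
  have "\<exists>!s. s \<in> posdef_cone \<and> s ** s = x"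
    using posdef_sqrt_exists[OF assms] posdef_sqrt_unique by metis
  from theI'[OF this] show "msqrt x \<in> posdef_cone" "msqrt x ** msqrt x = x"
    unfolding msqrt_def by blast+
qed

lemma msqrt_eqI: "s \<in> posdef_cone \<Longrightarrow> s ** s = x \<Longrightarrow> msqrt x = s"
  using msqrt[of x] posdef_square posdef_sqrt_unique by metis

text \<open>Compactness of the unit sphere gives the minimum of the form of \<open>x\<close> and the
  maximum of the form of \<open>y\<close>; their quotient serves as \<epsilon>, and homogeneity
  extends the bound to all vectors.\<close>

lemma posdef_minus_small_multiple:
  assumes x: "x \<in> posdef_cone" and y: "y \<in> posdef_cone"
  obtains \<epsilon> where "0 < \<epsilon>" "\<And>t. 0 \<le> t \<Longrightarrow> t < \<epsilon> \<Longrightarrow> x - t *\<^sub>R y \<in> posdef_cone"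
proof -
  define S where "S = sphere (0 :: real ^ 'a) 1"
  have S: "compact S" "S \<noteq> {}" by (simp_all add: S_def)
  have cont: "continuous_on S (\<lambda>h. h \<bullet> (z *v h))" for z :: "real ^ 'a ^ 'a"
    by (intro continuous_intros)
  obtain a where a: "a \<in> S" "\<And>h. h \<in> S \<Longrightarrow> a \<bullet> (x *v a) \<le> h \<bullet> (x *v h)"
    using continuous_attains_inf[OF S cont] by metis
  obtain b where b: "b \<in> S" "\<And>h. h \<in> S \<Longrightarrow> h \<bullet> (y *v h) \<le> b \<bullet> (y *v b)"
    using continuous_attains_sup[OF S cont] by metis
  have pos: "a \<bullet> (x *v a) > 0" "b \<bullet> (y *v b) > 0"
    using a(1) b(1) by (auto simp: S_def intro!: posdef_pos x y)
  show thesis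
  proof
    show "0 < a \<bullet> (x *v a) / (b \<bullet> (y *v b))" using pos by simp
  next
    fix t assume t: "0 \<le> t" "t < a \<bullet> (x *v a) / (b \<bullet> (y *v b))"
    have unit: "0 < h \<bullet> ((x - t *\<^sub>R y) *v h)" if "h \<in> S" for h
    proof -
      have "t * (h \<bullet> (y *v h)) \<le> t * (b \<bullet> (y *v b))" using b that t by (simp add: mult_left_mono)
      also have "\<dots> < a \<bullet> (x *v a)" using t pos by (simp add: field_simps)
      also have "\<dots> \<le> h \<bullet> (x *v h)" using a that by simp
      finally show ?thesis
        by (simp add: matrix_vector_mult_diff_rdistrib inner_diff_right scaleR_matrix_vector_assoc[symmetric])
    qed
    have "0 < h \<bullet> ((x - t *\<^sub>R y) *v h)" if "h \<noteq> 0" for h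
    proof -
      have "0 < (h /\<^sub>R norm h) \<bullet> ((x - t *\<^sub>R y) *v (h /\<^sub>R norm h))"
        using that by (intro unit) (simp add: S_def)
      also have "\<dots> = (h \<bullet> ((x - t *\<^sub>R y) *v h)) / (norm h)\<^sup>2"
        by (simp add: matrix_vector_mult_scaleR power2_eq_square divide_inverse)
      finally show ?thesis using that by (simp add: zero_less_divide_iff)
    qed
    then show "x - t *\<^sub>R y \<in> posdef_cone"
      using x y by (simp add: posdef_cone_iff transpose_diff transpose_scalar)
  qed
qed

lemma posdef_minus_eventually:
  assumes "x \<in> posdef_cone" "y \<in> posdef_cone"
  shows "\<forall>\<^sub>F t in at_top. x - (1 / t) *\<^sub>R y \<in> posdef_cone"
proof -
  obtain e where e: "0 < e" "\<And>t. 0 \<le> t \<Longrightarrow> t < e \<Longrightarrow> x - t *\<^sub>R y \<in> posdef_cone"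
    using posdef_minus_small_multiple[OF assms] by metis
  have "\<forall>\<^sub>F t in at_top. t > 1 / e" by (rule eventually_gt_at_top)
  then show ?thesis
  proof eventually_elim
    case (elim t)
    moreover from elim have "t > 0" using e by (meson divide_pos_pos less_trans zero_less_one)
    ultimately show ?case using e by (intro e(2)) (simp_all add: field_simps)
  qed
qed

lemma posdef_scale_minus_eventually:
  assumes "x \<in> posdef_cone" "y \<in> posdef_cone"
  shows "\<forall>\<^sub>F t in at_top. t *\<^sub>R x - y \<in> posdef_cone"
  using posdef_minus_eventually[OF assms] eventually_gt_at_top[of 0]
proof eventually_elim
  case (elim t)
  then have "t *\<^sub>R (x - (1 / t) *\<^sub>R y) \<in> posdef_cone" by blast
  then show ?case using elim by (simp add: scaleR_diff_right)
qed

text \<open>Together with \<open>posdef_sqrt_minus_one\<close> this shows that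
  \<open>m ** m - mat 1\<close> runs exactly over the cone when \<open>m\<close> runs over the
  matrices exceeding the identity.\<close>

lemma posdef_square_minus_one:
  assumes "m \<in> posdef_cone" "m - mat 1 \<in> posdef_cone"
  shows "m ** m - mat 1 \<in> posdef_cone"
proof -
  have "m ** m - mat 1 = (m - mat 1) ** mat 1 ** (m - mat 1) + 2 *\<^sub>R (m - mat 1)"
    by (simp add: mm.diff_left mm.diff_right scaleR_2)
  then show ?thesis using assms posdef_quad[OF assms(2) posdef_mat_1] posdef_scaleR[OF assms(2), of 2]
    by (simp add: posdef_add)
qed

text \<open>In an eigenbasis of the root, its eigenvalues satisfy \<open>f i > 0\<close> and
  \<open>f i * f i > 1\<close>, hence \<open>f i > 1\<close>.\<close>

lemma posdef_sqrt_minus_one: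
  assumes u: "u \<in> posdef_cone"
  shows "msqrt (mat 1 + u) - mat 1 \<in> posdef_cone"
proof -
  let ?w = "msqrt (mat 1 + u)"
  have w: "?w \<in> posdef_cone" "?w ** ?w = mat 1 + u"
    using msqrt[OF posdef_add[OF posdef_mat_1 u]] by auto
  obtain k f where k: "orthogonal_matrix k" "?w = k ** diagm f ** transpose k" "\<And>i. f i > 0"
    using posdef_diagonalization[OF w(1)] by metis
  have kk: "transpose k ** k = mat 1" "k ** transpose k = mat 1" using k by (auto simp: orthogonal_matrix_def)
  have one: "mat 1 = k ** diagm (\<lambda>_. 1) ** transpose k"
    using kk by (simp add: diagm_one)
  have d: "u = k ** diagm (\<lambda>i. f i * f i - 1) ** transpose k"
  proof -
    have "diagm (\<lambda>i. f i * f i - 1) = diagm f ** diagm f - diagm (\<lambda>_. 1)"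
      by (simp add: vec_eq_iff)
    then have "k ** diagm (\<lambda>i. f i * f i - 1) ** transpose k = ?w ** ?w - mat 1"
      unfolding k(2) orthogonal_conjugate_cancel[OF k(1)] by (subst one) (simp only: mm.diff_left mm.diff_right)
    then show ?thesis using w by simp
  qed
  have "transpose k ** u ** transpose (transpose k) \<in> posdef_cone"
    using k by (intro posdef_congruence u orthogonal_matrix_invertible) simp
  also have "transpose k ** u ** transpose (transpose k) =
      (transpose k ** k) ** diagm (\<lambda>i. f i * f i - 1) ** (transpose k ** k)"
    by (subst d) (simp only: matrix_mul_assoc transpose_transpose)
  finally have "\<And>i. f i * f i - 1 > 0" by (simp add: kk diagm_posdef_iff)
  then have f1: "f i - 1 > 0" for i
    using k(3)[of i] by (smt (verit) mult_le_one)
  have "?w - mat 1 = k ** diagm (\<lambda>i. f i - 1) ** transpose k"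
  proof -
    have "diagm (\<lambda>i. f i - 1) = diagm f - diagm (\<lambda>_. 1)" by (simp add: vec_eq_iff)
    then show ?thesis
      by (subst k(2), subst one) (simp only: mm.diff_left mm.diff_right)
  qed
  then show ?thesis using f1 k(1)
    by (simp add: posdef_congruence orthogonal_matrix_invertible diagm_posdef_iff)
qed

section \<open>Functional equations for the determinant and the trace\<close>

text \<open>Cauchy's equation on the half-line: integer multiples by induction, then rational
  arguments, then all positive ones by continuity.\<close>

lemma additive_on_positive_linear:
  fixes f :: "real \<Rightarrow> real"
  assumes add: "\<And>s t. 0 < s \<Longrightarrow> 0 < t \<Longrightarrow> f (s + t) = f s + f t"
    and cont: "continuous_on {0<..} f" and t: "0 < t"
  shows "f t = t * f 1"
proof -
  have nat: "f (real (Suc n) * s) = real (Suc n) * f s" if "0 < s" for n s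
  proof (induction n)
    case (Suc n)
    have "f (real (Suc (Suc n)) * s) = f (real (Suc n) * s + s)" by (simp add: algebra_simps)
    also have "\<dots> = f (real (Suc n) * s) + f s" using that by (intro add) simp_all
    finally show ?case using Suc.IH by (simp add: algebra_simps)
  qed simp
  have rat: "f (real k / real (Suc n)) = real k / real (Suc n) * f 1" if k: "0 < k" for k n
  proof -
    obtain l where l: "k = Suc l" using k by (cases k) auto
    have "real (Suc n) * f (real k / real (Suc n)) = f (real (Suc n) * (real k / real (Suc n)))"
      using k by (intro nat[symmetric]) simp
    also have "\<dots> = f (real (Suc l) * 1)" by (simp add: l)
    also have "\<dots> = real k * f 1" by (subst nat) (simp_all add: l)
    finally show ?thesis by (simp add: field_simps)
  qed
  \<comment> \<open>Rounding up keeps the numerators positive, so that \<open>rat\<close> applies,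
    and the error is at most \<open>1 / Suc n\<close>.\<close>
  define r where "r n = real (nat \<lceil>t * real (Suc n)\<rceil>) / real (Suc n)" for n
  have lower: "t \<le> r n" for n
    using t by (simp add: r_def pos_le_divide_eq real_nat_ceiling_ge)
  have upper: "r n \<le> t + 1 / real (Suc n)" for n
  proof -
    have "real (nat \<lceil>t * real (Suc n)\<rceil>) \<le> t * real (Suc n) + 1"
      using t ceiling_correct[of "t * real (Suc n)"] by (simp add: of_nat_nat)
    then have "r n \<le> (t * real (Suc n) + 1) / real (Suc n)"
      unfolding r_def by (intro divide_right_mono) simp_all
    then show ?thesis by (simp add: add_divide_distrib)
  qed
  have "(\<lambda>n. t + 1 / real (Suc n)) \<longlonglongrightarrow> t + 0"
    by (intro tendsto_intros LIMSEQ_Suc[OF lim_1_over_n])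
  then have rt: "r \<longlonglongrightarrow> t"
    by (intro tendsto_sandwich[of "\<lambda>_. t" r sequentially "\<lambda>n. t + 1 / real (Suc n)" t])
      (use lower upper in \<open>auto simp del: of_nat_Suc\<close>)
  have pos: "0 < nat \<lceil>t * real (Suc n)\<rceil>" for n using t by simp
  have "isCont f t" using cont t by (simp add: continuous_on_eq_continuous_at)
  then have "(\<lambda>n. f (r n)) \<longlonglongrightarrow> f t" using rt isCont_tendsto_compose by blast
  moreover have "f (r n) = r n * f 1" for n unfolding r_def by (rule rat) (rule pos)
  moreover have "(\<lambda>n. r n * f 1) \<longlonglongrightarrow> t * f 1" by (intro tendsto_intros rt)
  ultimately show ?thesis using LIMSEQ_unique by auto
qed

section \<open>Matrices that differ from the identity in one coordinate plane only\<close>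

definition block2 :: "'n \<Rightarrow> 'n \<Rightarrow> real \<Rightarrow> real \<Rightarrow> real \<Rightarrow> real \<Rightarrow> real ^ 'n ^ 'n" where
  "block2 i j a b c d = (\<chi> r s.
     if r = i then (if s = i then a else if s = j then b else 0)
     else if r = j then (if s = i then c else if s = j then d else 0)
     else if r = s then 1 else 0)"

lemma block2_nth: "block2 i j a b c d $ r $ s =
    (if r = i then (if s = i then a else if s = j then b else 0)
     else if r = j then (if s = i then c else if s = j then d else 0)
     else if r = s then 1 else 0)"
  by (simp add: block2_def)

lemma sum_two_deltas:
  fixes f :: "'n::finite \<Rightarrow> real"
  assumes "i \<noteq> j"
  shows "(\<Sum>k\<in>UNIV. (if k = i then a else if k = j then b else 0) * f k) = a * f i + b * f j"
proof -
  have "(\<Sum>k\<in>UNIV. (if k = i then a else if k = j then b else 0) * f k) =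
      (\<Sum>k\<in>UNIV. (if k = i then a * f i else 0) + (if k = j then b * f j else 0))"
    using assms by (intro sum.cong) auto
  then show ?thesis by (simp add: sum.distrib)
qed

lemma block2_mul_nth:
  assumes "i \<noteq> j"
  shows "(block2 i j a b c d ** x) $ r $ s =
    (if r = i then a * x $ i $ s + b * x $ j $ s
     else if r = j then c * x $ i $ s + d * x $ j $ s else x $ r $ s)"
proof -
  consider "r = i" | "r = j" "r \<noteq> i" | "r \<noteq> i" "r \<noteq> j" by blast
  then show ?thesis
  proof cases
    case 3
    have "(block2 i j a b c d ** x) $ r $ s = (\<Sum>k\<in>UNIV. if k = r then x $ r $ s else 0)"
      unfolding matrix_matrix_mult_def vec_lambda_beta using 3
      by (intro sum.cong) (auto simp: block2_nth)
    then show ?thesis using 3 by simp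
  qed (use assms in \<open>simp_all add: matrix_matrix_mult_def block2_nth sum_two_deltas\<close>)
qed

text \<open>Products reduce to those of 2 by 2 matrices, so that the functional equations can be
  tested on explicit entries.\<close>

lemma block2_mul:
  assumes "i \<noteq> j"
  shows "block2 i j a b c d ** block2 i j a' b' c' d' =
    block2 i j (a * a' + b * c') (a * b' + b * d') (c * a' + d * c') (c * b' + d * d')"
  using assms by (simp add: vec_eq_iff block2_mul_nth) (simp add: block2_nth)

lemma transpose_block2: "i \<noteq> j \<Longrightarrow> transpose (block2 i j a b c d) = block2 i j a c b d"
  by (auto simp: vec_eq_iff transpose_def block2_nth)

lemma block2_one: "i \<noteq> j \<Longrightarrow> block2 i j 1 0 0 1 = mat 1"
  by (auto simp: vec_eq_iff block2_nth mat_def)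

lemma block2_diagm: "i \<noteq> j \<Longrightarrow> block2 i j a 0 0 d = diagm (\<lambda>r. if r = i then a else if r = j then d else 1)"
  by (auto simp: vec_eq_iff block2_nth)

text \<open>Gaussian elimination writes the matrix as a congruence of the diagonal one with entries
  \<open>a\<close> and the Schur complement \<open>d - b\<^sup>2 / a\<close>.\<close>

lemma block2_posdef:
  assumes ij: "i \<noteq> j" and a: "0 < a" and det: "b\<^sup>2 < a * d"
  shows "block2 i j a b b d \<in> posdef_cone"
proof -
  let ?L = "block2 i j 1 0 (b / a) 1" and ?D = "block2 i j a 0 0 (d - b\<^sup>2 / a)"
  have D: "?D \<in> posdef_cone"
    using a det unfolding block2_diagm[OF ij] diagm_posdef_iff by (simp add: field_simps)
  have "?L ** block2 i j 1 0 (- b / a) 1 = mat 1" "block2 i j 1 0 (- b / a) 1 ** ?L = mat 1"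
    by (simp_all add: block2_mul[OF ij] block2_one[OF ij])
  then have "invertible ?L" by (auto simp: invertible_def)
  from posdef_congruence[OF D this] show ?thesis
    using a by (simp add: transpose_block2[OF ij] block2_mul[OF ij] power2_eq_square)
qed

section \<open>Orthogonal conjugation; characterising the log-determinant and the trace\<close>

lemma conjugate_posdef:
  "orthogonal_matrix k \<Longrightarrow> x \<in> posdef_cone \<Longrightarrow> k ** x ** transpose k \<in> posdef_cone"
  by (simp add: posdef_congruence orthogonal_matrix_invertible)

lemma conjugate_scaled_one:
  fixes k :: "real ^ 'n ^ 'n"
  assumes "orthogonal_matrix k"
  shows "k ** (c *\<^sub>R mat 1) ** transpose k = c *\<^sub>R mat 1"
  using assms by (simp add: mm.scaleR_left mm.scaleR_right orthogonal_matrix_def)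

lemma det_conjugate:
  fixes k :: "real ^ 'n ^ 'n"
  assumes "orthogonal_matrix k"
  shows "det (k ** x ** transpose k) = det x"
proof -
  have "det k * det k = 1"
    using arg_cong[OF assms[unfolded orthogonal_matrix], of det] by (simp add: det_mul)
  then show ?thesis by (simp add: det_mul algebra_simps)
qed

lemma det_posdef_pos:
  assumes "x \<in> posdef_cone"
  shows "0 < det x"
proof -
  obtain k f where "orthogonal_matrix k" "x = k ** diagm f ** transpose k" "\<And>i. f i > 0"
    using posdef_diagonalization[OF assms] by metis
  then show ?thesis by (simp add: det_conjugate prod_pos)
qed

text \<open>On diagonal matrices \<open>f\<close> is an additive function of the logarithms of the
  entries. The equation for non-commuting \<open>s\<close> and \<open>t\<close> forces every
  coordinate to contribute through the same additive function \<omega>, so only the sum of the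
  logarithms matters. Linearity of \<omega> comes later, from continuity.\<close>

lemma quadratic_log_diagonal:
  fixes f :: "real ^ 'n ^ 'n \<Rightarrow> real"
  assumes quad: "\<And>s t. s \<in> posdef_cone \<Longrightarrow> t \<in> posdef_cone \<Longrightarrow> f (s ** t ** s) = 2 * f s + f t"
  obtains \<omega> where "\<And>s t. \<omega> (s + t) = \<omega> s + \<omega> t"
    "\<And>g. (\<And>i. g i > 0) \<Longrightarrow> f (diagm g) = \<omega> (ln (det (diagm g)))"
proof -
  have f1: "f (mat 1) = 0" using quad[of "mat 1" "mat 1"] by simp
  have fsq: "f (t ** t) = 2 * f t" if "t \<in> posdef_cone" for t
    using quad[OF that posdef_mat_1] by (simp add: f1)
  \<comment> \<open>Both sides equal \<open>2 * f s + 2 * f t\<close>.\<close>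
  have swap: "f (s ** (t ** t) ** s) = f (t ** (s ** s) ** t)"
    if "s \<in> posdef_cone" "t \<in> posdef_cone" for s t
    using that by (simp add: quad posdef_square fsq)
  have mult: "f (diagm (\<lambda>i. g i * h i)) = f (diagm g) + f (diagm h)"
    if g: "\<And>i. g i > 0" and h: "\<And>i. h i > 0" for g h :: "'n \<Rightarrow> real"
  proof -
    let ?s = "diagm (\<lambda>i. sqrt (g i))"
    have s: "?s \<in> posdef_cone" "diagm h \<in> posdef_cone" using g h by (auto simp: diagm_posdef_iff)
    have e: "?s ** diagm h ** ?s = diagm (\<lambda>i. g i * h i)" "?s ** ?s = diagm g"
      using g by (auto simp: vec_eq_iff less_imp_le algebra_simps)
    show ?thesis using quad[OF s] fsq[OF s(1)] unfolding e by simp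
  qed
  define \<zeta> where "\<zeta> a = f (diagm (\<lambda>i. exp (a i)))" for a :: "'n \<Rightarrow> real"
  have \<zeta>_add: "\<zeta> (\<lambda>i. a i + b i) = \<zeta> a + \<zeta> b" for a b
    unfolding \<zeta>_def exp_add by (rule mult) simp_all
  have \<zeta>_0: "\<zeta> (\<lambda>_. 0) = 0" using \<zeta>_add[of "\<lambda>_. 0" "\<lambda>_. 0"] by simp
  define u where "u i a = (\<lambda>r. if r = i then a else 0)" for i :: 'n and a :: real
  have u_add: "\<zeta> (u i (a + b)) = \<zeta> (u i a) + \<zeta> (u i b)" for i a b
  proof -
    have "u i (a + b) = (\<lambda>r. u i a r + u i b r)" by (auto simp: u_def)
    then show ?thesis by (simp add: \<zeta>_add)
  qed
  have u_0: "\<zeta> (u i 0) = 0" for i using u_add[of i 0 0] by simp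
  have inv: "\<zeta> (u i (- a)) = - \<zeta> (u i a)" for i a
    using u_add[of i a "- a"] u_0 by simp
  have neg: "\<zeta> (u i a) = \<zeta> (u j a)" if ij: "i \<noteq> j" and a: "a < 0" for i j a
  proof -
    \<comment> \<open>The matrices \<open>s t\<^sup>2 s\<close> and \<open>t s\<^sup>2 t\<close> below have the same value under \<open>f\<close>. The parameters are
      chosen so that they have equal off-diagonal entries and swapped diagonal entries whose ratio
      is \<open>exp (2 * a)\<close>; a diagonal congruence \<open>d\<close> of determinant 1 then maps one to the other.\<close>
    define \<theta> where "\<theta> = exp (2 * a)"
    define \<sigma> where "\<sigma> = 2 / \<theta>"
    define \<beta> where "\<beta> = \<sigma>\<^sup>2 * (1 - \<theta>) / (2 * \<sigma> - 1)"
    define b where "b = sqrt \<beta>"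
    have \<theta>: "0 < \<theta>" "\<theta> < 1" "exp a * exp a = \<theta>" using a by (auto simp: \<theta>_def exp_add[symmetric])
    have \<sigma>: "\<sigma> > 2" "\<theta> * \<sigma> = 2" using \<theta> by (auto simp: \<sigma>_def field_simps)
    have \<beta>: "\<beta> > 0" using \<theta> \<sigma> by (simp add: \<beta>_def)
    have bb: "b * b = \<beta>" using \<beta> by (simp add: b_def)
    \<comment> \<open>This balance of the diagonal entries is linear in \<beta>. Since
      \<open>\<theta> * \<sigma>\<^sup>2 = 2 * \<sigma>\<close>, solving it gives the denominator
      \<open>2 * \<sigma> - 1\<close> in the definition of \<beta>.\<close>
    have rel: "\<theta> * (\<sigma>\<^sup>2 * (1 + \<beta>)) = \<sigma>\<^sup>2 + \<beta>"
    proof -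
      have "\<beta> * (2 * \<sigma> - 1) = \<sigma>\<^sup>2 * (1 - \<theta>)" using \<sigma> by (simp add: \<beta>_def)
      moreover have "\<theta> * \<sigma>\<^sup>2 = 2 * \<sigma>" using \<sigma> by (simp add: power2_eq_square)
      ultimately show ?thesis by (simp add: algebra_simps)
    qed
    \<comment> \<open>This is positivity of the 2 by 2 determinant of \<open>?t\<close>, because
      \<open>b * b = \<beta>\<close>.\<close>
    have "\<beta> < \<sigma>"
    proof -
      have "\<sigma> * (\<sigma> * (1 - \<theta>)) < \<sigma> * (2 * \<sigma> - 1)"
        using \<sigma> \<theta> by (intro mult_strict_left_mono) (auto simp: algebra_simps)
      then show ?thesis using \<sigma> by (simp add: \<beta>_def divide_less_eq power2_eq_square algebra_simps)
    qed
    let ?s = "block2 i j \<sigma> 0 0 1" and ?t = "block2 i j 1 b b \<sigma>"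
      and ?d = "block2 i j (exp a) 0 0 (exp (- a))"
    have pd: "?s \<in> posdef_cone" "?t \<in> posdef_cone" "?d \<in> posdef_cone"
      using \<sigma> \<open>\<beta> < \<sigma>\<close> bb by (auto intro!: block2_posdef[OF ij] simp: power2_eq_square exp_add[symmetric])
    have ea: "exp a * exp (- a) = 1" "exp (- a) * exp (- a) = 1 / \<theta>"
      by (simp_all add: exp_add[symmetric] \<theta>_def exp_minus field_simps)
    have "?d ** (?s ** (?t ** ?t) ** ?s) ** ?d = ?t ** (?s ** ?s) ** ?t"
    proof -
      have 1: "?s ** (?t ** ?t) ** ?s =
          block2 i j (\<sigma>\<^sup>2 * (1 + \<beta>)) (\<sigma> * b * (1 + \<sigma>)) (\<sigma> * b * (1 + \<sigma>)) (\<beta> + \<sigma>\<^sup>2)"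
        by (simp add: block2_mul[OF ij] bb[symmetric] power2_eq_square algebra_simps)
      have 2: "?t ** (?s ** ?s) ** ?t =
          block2 i j (\<sigma>\<^sup>2 + \<beta>) (\<sigma> * b * (1 + \<sigma>)) (\<sigma> * b * (1 + \<sigma>)) (\<sigma>\<^sup>2 * (1 + \<beta>))"
        by (simp add: block2_mul[OF ij] bb[symmetric] power2_eq_square algebra_simps)
      have 3: "?d ** block2 i j p q q r ** ?d = block2 i j (\<theta> * p) q q (r / \<theta>)" for p q r
      proof -
        have "exp a * p * exp a = \<theta> * p" "exp a * q * exp (- a) = q" "exp (- a) * q * exp a = q"
            "exp (- a) * r * exp (- a) = r / \<theta>"
          using \<theta>(3) ea by (simp_all add: algebra_simps)
        then show ?thesis
          by (simp only: block2_mul[OF ij] mult_zero_left mult_zero_right add_0_left add_0_right)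
      qed
      have "(\<beta> + \<sigma>\<^sup>2) / \<theta> = \<sigma>\<^sup>2 * (1 + \<beta>)" using rel \<theta> by (simp add: field_simps)
      then show ?thesis unfolding 1 2 3 rel by simp
    qed
    then have "f (?t ** (?s ** ?s) ** ?t) = 2 * f ?d + f (?s ** (?t ** ?t) ** ?s)"
      using quad[OF pd(3) posdef_quad[OF pd(1) posdef_square[OF pd(2)]]] by simp
    then have "f ?d = 0" using swap[OF pd(1,2)] by simp
    moreover have "?d = diagm (\<lambda>r. exp (u i a r + u j (- a) r))"
      unfolding block2_diagm[OF ij] by (rule arg_cong[where f = diagm]) (use ij in \<open>auto simp: u_def\<close>)
    ultimately have "\<zeta> (u i a) + \<zeta> (u j (- a)) = 0"
      using \<zeta>_add[of "u i a" "u j (- a)"] by (simp add: \<zeta>_def)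
    then show ?thesis using inv[of j a] by simp
  qed
  \<comment> \<open>For positive \<open>a\<close>, apply \<open>neg\<close> to \<open>- a\<close>
    and use that the contributions are odd in \<open>a\<close>.\<close>
  have indep: "\<zeta> (u i a) = \<zeta> (u j a)" for i j a
    using neg[of i j a] neg[of i j "- a"] inv by (cases "i = j"; cases a "0 :: real" rule: linorder_cases)
      (auto simp: u_0)
  obtain i0 :: 'n where True by simp
  define \<omega> where "\<omega> t = \<zeta> (u i0 t)" for t
  have \<omega>_add: "\<omega> (s + t) = \<omega> s + \<omega> t" for s t
    unfolding \<omega>_def by (rule u_add)
  have \<omega>_0: "\<omega> 0 = 0" using \<omega>_add[of 0 0] by simp
  have partial: "\<zeta> (\<lambda>r. if r \<in> S then a r else 0) = \<omega> (sum a S)" for S a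
  proof (induction S rule: finite_induct[OF finite])
    case 1
    then show ?case by (simp add: \<zeta>_0 \<omega>_0)
  next
    case (2 i S)
    have "(\<lambda>r. if r \<in> insert i S then a r else 0) = (\<lambda>r. u i (a i) r + (if r \<in> S then a r else 0))"
      using 2 by (auto simp: u_def)
    then have "\<zeta> (\<lambda>r. if r \<in> insert i S then a r else 0) = \<zeta> (u i (a i)) + \<omega> (sum a S)"
      by (simp add: \<zeta>_add 2)
    also have "\<zeta> (u i (a i)) = \<omega> (a i)" unfolding \<omega>_def by (rule indep)
    finally show ?case using 2 by (simp add: \<omega>_add)
  qed
  show thesis
  proof
    show "\<omega> (s + t) = \<omega> s + \<omega> t" for s t by (rule \<omega>_add)
  next
    fix g :: "'n \<Rightarrow> real" assume g: "\<And>i. g i > 0"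
    have "f (diagm g) = \<zeta> (\<lambda>i. ln (g i))" using g by (simp add: \<zeta>_def)
    also have "\<dots> = \<omega> (\<Sum>i\<in>UNIV. ln (g i))" using partial[of UNIV "\<lambda>i. ln (g i)"] by simp
    also have "(\<Sum>i\<in>UNIV. ln (g i)) = ln (prod g UNIV)" using g by (intro ln_prod[symmetric]) (auto simp: less_imp_neq[THEN not_sym])
    finally show "f (diagm g) = \<omega> (ln (det (diagm g)))" by simp
  qed
qed

text \<open>Continuity on scalar matrices makes \<omega> linear. For general \<open>x\<close>,
  conjugation by a diagonalising \<open>k\<close> preserves the equation, so the diagonal result
  applies to the conjugated function; scalar matrices are fixed by conjugation and show that its
  additive function is again \<omega>.\<close>

theorem quadratic_log_equation:
  fixes f :: "real ^ 'n ^ 'n \<Rightarrow> real"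
  assumes quad: "\<And>s t. s \<in> posdef_cone \<Longrightarrow> t \<in> posdef_cone \<Longrightarrow> f (s ** t ** s) = 2 * f s + f t"
    and cont: "continuous_on {1<..} (\<lambda>c. f (c *\<^sub>R mat 1))"
  obtains \<kappa> where "\<And>x. x \<in> posdef_cone \<Longrightarrow> f x = \<kappa> * ln (det x)"
proof -
  define N where "N = real CARD('n)"
  have N: "N > 0" by (simp add: N_def)
  have lndet: "ln (det (c *\<^sub>R mat 1 :: real ^ 'n ^ 'n)) = N * ln c" if "c > 0" for c
    using that by (simp add: diagm_one[symmetric] ln_realpow N_def)
  have scalar: "t = ln (det (exp (t / N) *\<^sub>R mat 1 :: real ^ 'n ^ 'n))" for t
    using N by (simp add: lndet)
  obtain \<omega> where add: "\<And>s t. \<omega> (s + t) = \<omega> s + \<omega> t"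
    and \<omega>: "\<And>g. (\<And>i. g i > 0) \<Longrightarrow> f (diagm g) = \<omega> (ln (det (diagm g)))"
    using quadratic_log_diagonal[of f] quad by blast
  have \<omega>_eq: "\<omega> t = f (exp (t / N) *\<^sub>R mat 1)" for t
    using \<omega>[of "\<lambda>_. exp (t / N)"] scalar[of t] by (simp add: diagm_one)
  \<comment> \<open>For positive \<open>t\<close> the scalar \<open>exp (t / N)\<close> exceeds 1,
    where continuity is given; negative \<open>t\<close> follow by oddness.\<close>
  have "continuous_on {0<..} \<omega>"
    unfolding \<omega>_eq
    by (rule continuous_on_compose2[OF cont, where f = "\<lambda>t. exp (t / N)"])
      (use N in \<open>auto intro!: continuous_intros\<close>)
  then have pos: "\<omega> t = t * \<omega> 1" if "t > 0" for t
    using additive_on_positive_linear[of \<omega> t] add that by blast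
  have zero: "\<omega> 0 = 0" using add[of 0 0] by simp
  have "\<omega> t + \<omega> (- t) = 0" for t using add[of t "- t"] zero by simp
  then have lin: "\<omega> t = \<omega> 1 * t" for t
    using pos[of t] pos[of "- t"] zero by (cases t "0 :: real" rule: linorder_cases) (auto simp: algebra_simps add_eq_0_iff)
  have "f x = \<omega> 1 * ln (det x)" if x: "x \<in> posdef_cone" for x
  proof -
    obtain k g where k: "orthogonal_matrix k" "x = k ** diagm g ** transpose k" "\<And>i. g i > 0"
      using posdef_diagonalization[OF x] by metis
    define fk where "fk y = f (k ** y ** transpose k)" for y
    have quadk: "fk (s ** t ** s) = 2 * fk s + fk t" if "s \<in> posdef_cone" "t \<in> posdef_cone" for s t
      using quad[OF conjugate_posdef[OF k(1) that(1)] conjugate_posdef[OF k(1) that(2)]]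
      by (simp add: fk_def orthogonal_conjugate_cancel[OF k(1)])
    obtain \<omega>' where \<omega>': "\<And>g. (\<And>i. g i > 0) \<Longrightarrow> fk (diagm g) = \<omega>' (ln (det (diagm g)))"
      using quadratic_log_diagonal[of fk, OF quadk] by metis
    have "\<omega>' t = \<omega> t" for t
      using \<omega>'[of "\<lambda>_. exp (t / N)"] scalar[of t] \<omega>_eq[of t]
      by (simp add: diagm_one fk_def conjugate_scaled_one[OF k(1)])
    then have "f x = \<omega> (ln (det (diagm g)))"
      using \<omega>'[of g] k by (simp add: fk_def)
    also have "det (diagm g) = det x" unfolding k(2) by (rule det_conjugate[OF k(1), symmetric])
    also have "\<omega> (ln (det x)) = \<omega> 1 * ln (det x)" by (rule lin)
    finally show ?thesis .
  qed
  with that show ?thesis by blast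
qed

text \<open>Additivity breaks a diagonal matrix into single-coordinate increments, and
  \<open>swap\<close> gives all coordinates the same weight \<open>c\<close>. So \<phi> is
  \<open>c\<close> times the trace on diagonal matrices, and its value at the identity forces
  \<open>c = 0\<close>.\<close>

lemma tracial_diagonal_zero:
  fixes \<phi> :: "real ^ 'n ^ 'n \<Rightarrow> real"
  assumes add: "\<And>x y. x \<in> posdef_cone \<Longrightarrow> y \<in> posdef_cone \<Longrightarrow> \<phi> (x + y) = \<phi> x + \<phi> y"
    and scale: "\<And>c x. 0 < c \<Longrightarrow> x \<in> posdef_cone \<Longrightarrow> \<phi> (c *\<^sub>R x) = c * \<phi> x"
    and swap: "\<And>s t. s \<in> posdef_cone \<Longrightarrow> t \<in> posdef_cone \<Longrightarrow>
      \<phi> (s ** (t ** t) ** s) = \<phi> (t ** (s ** s) ** t)"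
    and one: "\<phi> (mat 1) = 0" and g: "\<And>i. g i > 0"
  shows "\<phi> (diagm g) = 0"
proof -
  \<comment> \<open>Increments are measured from the identity, since a diagonal matrix with a zero
    entry lies outside the cone.\<close>
  define u where "u i a = (\<lambda>r. if r = i then 1 + a else 1)" for i :: 'n and a :: real
  have u: "diagm (u i a) \<in> posdef_cone" if "a > 0" for i a
    using that by (simp add: u_def diagm_posdef_iff)
  have sc: "\<phi> (diagm (u i a)) = a * \<phi> (diagm (u i 1))" if a: "a > 0" for i a
  proof -
    have "diagm (u i a) + a *\<^sub>R mat 1 = mat 1 + a *\<^sub>R diagm (u i 1)"
      by (simp add: vec_eq_iff u_def mat_def algebra_simps)
    then have "\<phi> (diagm (u i a) + a *\<^sub>R mat 1) = \<phi> (mat 1 + a *\<^sub>R diagm (u i 1))" by simp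
    then show ?thesis using a u by (simp add: add scale posdef_scaleR one)
  qed
  have eq: "\<phi> (diagm (u i 1)) = \<phi> (diagm (u j 1))" for i j
  proof (cases "i = j")
    case False
    \<comment> \<open>Here \<open>s t\<^sup>2 s\<close> and \<open>t s\<^sup>2 t\<close> agree off the diagonal and have swapped diagonal entries 8 and 5.\<close>
    let ?s = "block2 i j 2 0 0 1" and ?t = "block2 i j 1 1 1 2"
    have st: "?s \<in> posdef_cone" "?t \<in> posdef_cone" by (auto intro!: block2_posdef[OF False])
    have pd: "block2 i j 8 6 6 5 \<in> posdef_cone" "block2 i j 5 6 6 8 \<in> posdef_cone"
      by (auto intro!: block2_posdef[OF False])
    have "\<phi> (block2 i j 8 6 6 5) = \<phi> (block2 i j 5 6 6 8)"
      using swap[OF st] by (simp add: block2_mul[OF False])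
    \<comment> \<open>The added matrices raise all four diagonal entries in the plane to 9, which
      transfers the swap of 8 and 5 to the increments.\<close>
    moreover have "block2 i j 8 6 6 5 + diagm (u j 3) = block2 i j 5 6 6 8 + diagm (u i 3)"
      using False by (auto simp: vec_eq_iff u_def block2_nth)
    then have "\<phi> (block2 i j 8 6 6 5 + diagm (u j 3)) = \<phi> (block2 i j 5 6 6 8 + diagm (u i 3))" by simp
    ultimately have "\<phi> (diagm (u j 3)) = \<phi> (diagm (u i 3))"
      using pd u by (simp add: add)
    then show ?thesis using sc[of 3] by simp
  qed simp
  obtain c where c: "\<And>i. \<phi> (diagm (u i 1)) = c" using eq by metis
  have partial: "\<phi> (diagm (\<lambda>r. if r \<in> S then 1 + h r else 1)) = c * sum h S"
    if h: "\<And>i. h i > 0" for S and h :: "'n \<Rightarrow> real"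
  proof (induction S rule: finite_induct[OF finite])
    case 1
    have "diagm (\<lambda>_. 1) = (mat 1 :: real ^ 'n ^ 'n)" by (simp add: diagm_one)
    then show ?case by (simp add: one)
  next
    case (2 i S)
    let ?d = "\<lambda>S. diagm (\<lambda>r. if r \<in> S then 1 + h r else 1)"
    have pd: "?d S \<in> posdef_cone" for S using h by (auto simp: diagm_posdef_iff add_pos_pos)
    have "?d (insert i S) + mat 1 = ?d S + diagm (u i (h i))"
      using 2 by (auto simp: vec_eq_iff u_def mat_def)
    then have "\<phi> (?d (insert i S) + mat 1) = \<phi> (?d S + diagm (u i (h i)))" by simp
    then have "\<phi> (?d (insert i S)) = \<phi> (?d S) + \<phi> (diagm (u i (h i)))"
      by (simp only: add[OF pd posdef_mat_1] add[OF pd u[OF h]] one add_0_right)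
    then show ?case using 2 sc[OF h, of i] c by (simp add: algebra_simps)
  qed
  have shift: "\<phi> (diagm h) = c * sum h UNIV" if h: "\<And>i. h i > 0" for h :: "'n \<Rightarrow> real"
  proof -
    have "diagm (\<lambda>r. 1 + h r) = mat 1 + diagm h" by (simp add: vec_eq_iff mat_def)
    moreover have "diagm h \<in> posdef_cone" using h by (simp add: diagm_posdef_iff)
    ultimately show ?thesis using partial[of h UNIV, OF h] by (simp add: add one)
  qed
  have "c * real CARD('n) = 0" using shift[of "\<lambda>_. 1"] by (simp add: diagm_one one)
  then have "c = 0" by simp
  then show ?thesis using shift[of g] g by simp
qed

text \<open>All hypotheses survive orthogonal conjugation, so the diagonal case applies to \<phi>
  composed with conjugation by a diagonalising \<open>k\<close>.\<close>

theorem tracial_zero: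
  fixes \<phi> :: "real ^ 'n ^ 'n \<Rightarrow> real"
  assumes add: "\<And>x y. x \<in> posdef_cone \<Longrightarrow> y \<in> posdef_cone \<Longrightarrow> \<phi> (x + y) = \<phi> x + \<phi> y"
    and scale: "\<And>c x. 0 < c \<Longrightarrow> x \<in> posdef_cone \<Longrightarrow> \<phi> (c *\<^sub>R x) = c * \<phi> x"
    and swap: "\<And>s t. s \<in> posdef_cone \<Longrightarrow> t \<in> posdef_cone \<Longrightarrow>
      \<phi> (s ** (t ** t) ** s) = \<phi> (t ** (s ** s) ** t)"
    and one: "\<phi> (mat 1) = 0" and x: "x \<in> posdef_cone"
  shows "\<phi> x = 0"
proof -
  obtain k g where k: "orthogonal_matrix k" "x = k ** diagm g ** transpose k" "\<And>i. g i > 0"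
    using posdef_diagonalization[OF x] by metis
  note conj = conjugate_posdef[OF k(1)]
  have "\<phi> (k ** diagm g ** transpose k) = 0"
  proof (rule tracial_diagonal_zero[where \<phi> = "\<lambda>y. \<phi> (k ** y ** transpose k)"])
    fix s t :: "real ^ 'n ^ 'n" assume "s \<in> posdef_cone" "t \<in> posdef_cone"
    then show "\<phi> (k ** (s ** (t ** t) ** s) ** transpose k) = \<phi> (k ** (t ** (s ** s) ** t) ** transpose k)"
      using swap[of "k ** s ** transpose k" "k ** t ** transpose k"] conj
      by (simp add: orthogonal_conjugate_cancel[OF k(1)])
  qed (use conjugate_scaled_one[OF k(1), of 1] in
      \<open>simp_all add: mm.add_left mm.add_right mm.scaleR_left mm.scaleR_right add scale conj one k(3)\<close>)
  then show ?thesis using k by simp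
qed

section \<open>The Kummer-Wishart functional equation\<close>

text \<open>\<open>w\<close> and \<open>m\<close> are the square roots of \<open>e + u\<close> and \<open>e + x\<close>, where \<open>x\<close> is the argument of \<open>C\<close>.\<close>

definition kummer_eq :: "(real ^ 'n ^ 'n \<Rightarrow> real) \<Rightarrow> (real ^ 'n ^ 'n \<Rightarrow> real) \<Rightarrow>
    (real ^ 'n ^ 'n \<Rightarrow> real) \<Rightarrow> (real ^ 'n ^ 'n \<Rightarrow> real) \<Rightarrow> bool" where
  "kummer_eq A B C D \<longleftrightarrow> (\<forall>w m. w \<in> posdef_cone \<longrightarrow> w - mat 1 \<in> posdef_cone \<longrightarrow>
     m \<in> posdef_cone \<longrightarrow> m - mat 1 \<in> posdef_cone \<longrightarrow>
     A (w ** w - mat 1) + B (w ** (m ** m - mat 1) ** w) =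
     C (m ** m - mat 1) + D (m ** (w ** w - mat 1) ** m))"

lemma kummer_eqD:
  assumes "kummer_eq A B C D" "w \<in> posdef_cone" "w - mat 1 \<in> posdef_cone"
    "m \<in> posdef_cone" "m - mat 1 \<in> posdef_cone"
  shows "A (w ** w - mat 1) + B (w ** (m ** m - mat 1) ** w) =
     C (m ** m - mat 1) + D (m ** (w ** w - mat 1) ** m)"
  using assms by (simp add: kummer_eq_def)

lemma kummer_eq_swap: "kummer_eq A B C D \<Longrightarrow> kummer_eq C D A B"
  unfolding kummer_eq_def by metis

lemma scaled_one_minus_one_posdef: "1 < c \<Longrightarrow> c *\<^sub>R mat 1 - mat 1 \<in> posdef_cone"
  using posdef_scaleR[OF posdef_mat_1, of "c - 1"] by (simp add: scaleR_diff_left)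

lemma one_plus_msqrt:
  assumes "u \<in> posdef_cone"
  shows "msqrt (mat 1 + u) \<in> posdef_cone" "msqrt (mat 1 + u) - mat 1 \<in> posdef_cone"
    "msqrt (mat 1 + u) ** msqrt (mat 1 + u) = mat 1 + u"
  using assms posdef_sqrt_minus_one[OF assms] msqrt[OF posdef_add[OF posdef_mat_1 assms]] by auto

lemma kummer_eqD_msqrt:
  assumes "kummer_eq A B C D" "w \<in> posdef_cone" "w - mat 1 \<in> posdef_cone" "x \<in> posdef_cone"
  shows "A (w ** w - mat 1) + B (w ** x ** w) =
     C x + D (msqrt (mat 1 + x) ** (w ** w - mat 1) ** msqrt (mat 1 + x))"
  using kummer_eqD[OF assms(1-3) one_plus_msqrt(1,2)[OF assms(4)]] one_plus_msqrt(3)[OF assms(4)]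
  by simp

text \<open>A scalar \<open>w\<close> commutes with everything, so the root of
  \<open>mat 1 + x\<close> enters only through its square.\<close>

lemma kummer_eq_scalar:
  assumes eq: "kummer_eq A B C D" and t: "0 < t" and x: "x \<in> posdef_cone"
  shows "A (t *\<^sub>R mat 1) + B ((1 + t) *\<^sub>R x) = C x + D (t *\<^sub>R mat 1 + t *\<^sub>R x)"
proof -
  let ?w = "sqrt (1 + t) *\<^sub>R mat 1 :: real ^ 'a ^ 'a"
  have "?w \<in> posdef_cone" "?w - mat 1 \<in> posdef_cone"
    using t by (auto intro!: posdef_scaleR scaled_one_minus_one_posdef)
  note E = kummer_eqD_msqrt[OF eq this x]
  have "?w ** ?w - mat 1 = t *\<^sub>R mat 1"
    using t by (simp add: mm.scaleR_left mm.scaleR_right scaleR_left_distrib)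
  moreover have "?w ** x ** ?w = (1 + t) *\<^sub>R x"
    using t by (simp add: mm.scaleR_left mm.scaleR_right)
  moreover have "msqrt (mat 1 + x) ** (t *\<^sub>R mat 1) ** msqrt (mat 1 + x) = t *\<^sub>R mat 1 + t *\<^sub>R x"
    using one_plus_msqrt(3)[OF x] by (simp add: mm.scaleR_left mm.scaleR_right scaleR_right_distrib)
  ultimately show ?thesis using E by simp
qed

section \<open>Limits at the origin and the logarithmic differences\<close>

lemma matrix_tendstoI:
  "(\<And>i j. ((\<lambda>t. f t $ i $ j) \<longlongrightarrow> x $ i $ j) F) \<Longrightarrow> (f \<longlongrightarrow> (x :: real ^ 'n ^ 'm)) F"
  by (intro vec_tendstoI)

lemma inverse_tendsto_0: "((\<lambda>t :: real. 1 / t) \<longlongrightarrow> 0) at_top"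
  using tendsto_inverse_0_at_top[OF filterlim_ident] by (simp add: inverse_eq_divide)

lemma msqrt_one_plus_tendsto:
  assumes y: "y \<in> posdef_cone"
  shows "((\<lambda>t. msqrt (mat 1 + (1 / t) *\<^sub>R y)) \<longlongrightarrow> mat 1) at_top"
proof -
  obtain k f where k: "orthogonal_matrix k" "y = k ** diagm f ** transpose k" "\<And>i. f i > 0"
    using posdef_diagonalization[OF y] by metis
  define w where "w t = k ** diagm (\<lambda>i. sqrt (1 + 1 / t * f i)) ** transpose k" for t
  have eq: "msqrt (mat 1 + (1 / t) *\<^sub>R y) = w t" if "0 < t" for t
  proof (rule msqrt_eqI)
    have nn: "0 < 1 + 1 / t * f i" for i using that k(3)[of i] by (simp add: add_pos_pos)
    then show "w t \<in> posdef_cone"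
      unfolding w_def by (intro conjugate_posdef k(1)) (simp add: diagm_posdef_iff)
    have "diagm (\<lambda>i. 1 + 1 / t * f i) = 1 *\<^sub>R mat 1 + (1 / t) *\<^sub>R diagm f"
      by (simp add: vec_eq_iff mat_def)
    then have "k ** diagm (\<lambda>i. 1 + 1 / t * f i) ** transpose k =
        k ** (1 *\<^sub>R mat 1) ** transpose k + (1 / t) *\<^sub>R y"
      by (simp only: k(2) mm.add_left mm.add_right mm.scaleR_left mm.scaleR_right)
    then show "w t ** w t = mat 1 + (1 / t) *\<^sub>R y"
      unfolding w_def orthogonal_conjugate_cancel[OF k(1)] conjugate_scaled_one[OF k(1)]
      using nn by (simp add: less_imp_le)
  qed
  have ent: "((\<lambda>t. diagm (\<lambda>i. sqrt (1 + 1 / t * f i)) $ i $ j) \<longlongrightarrow> mat 1 $ i $ j) at_top" for i j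
  proof -
    have "((\<lambda>t. sqrt (1 + 1 / t * f i)) \<longlongrightarrow> sqrt (1 + 0 * f i)) at_top"
      by (intro tendsto_intros inverse_tendsto_0)
    then show ?thesis by (cases "i = j") (auto simp: mat_def)
  qed
  have "(w \<longlongrightarrow> k ** mat 1 ** transpose k) at_top"
    unfolding w_def by (intro mm.tendsto tendsto_const matrix_tendstoI ent)
  then have "(w \<longlongrightarrow> mat 1) at_top"
    using k(1) by (simp add: orthogonal_matrix_def)
  moreover have "\<forall>\<^sub>F t in at_top. w t = msqrt (mat 1 + (1 / t) *\<^sub>R y)"
    using eventually_gt_at_top[of 0] by eventually_elim (simp only: eq)
  ultimately show ?thesis by (rule Lim_transform_eventually)
qed

text \<open>Put \<open>u = (1 / t) *\<^sub>R y\<close>: the root \<open>w t\<close> of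
  \<open>mat 1 + u\<close> tends to the identity, so the argument of \<open>B\<close> tends to
  \<open>m ** m - mat 1\<close>. Only the difference of the \<open>D\<close> and \<open>A\<close>
  terms is controlled, and its limit does not depend on \<open>y\<close>.\<close>

lemma kummer_limit:
  assumes eq: "kummer_eq A B C D" and B: "continuous_on posdef_cone B"
    and m: "m \<in> posdef_cone" "m - mat 1 \<in> posdef_cone" and y: "y \<in> posdef_cone"
  shows "((\<lambda>t. D ((1 / t) *\<^sub>R (m ** y ** m)) - A ((1 / t) *\<^sub>R y)) \<longlongrightarrow>
    B (m ** m - mat 1) - C (m ** m - mat 1)) at_top"
proof -
  let ?x = "m ** m - mat 1"
  define w where "w t = msqrt (mat 1 + (1 / t) *\<^sub>R y)" for t
  have x: "?x \<in> posdef_cone" by (rule posdef_square_minus_one[OF m])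
  have w: "w t \<in> posdef_cone" "w t - mat 1 \<in> posdef_cone" "w t ** w t = mat 1 + (1 / t) *\<^sub>R y" if "0 < t" for t
    unfolding w_def using that y by (auto intro!: one_plus_msqrt posdef_scaleR)
  have wx: "((\<lambda>t. w t ** ?x ** w t) \<longlongrightarrow> mat 1 ** ?x ** mat 1) at_top"
    unfolding w_def by (intro mm.tendsto tendsto_const msqrt_one_plus_tendsto y)
  have "\<forall>\<^sub>F t in at_top. w t ** ?x ** w t \<in> posdef_cone"
    using eventually_gt_at_top[of 0] by eventually_elim (auto intro: posdef_quad w x)
  then have "((\<lambda>t. B (w t ** ?x ** w t)) \<longlongrightarrow> B ?x) at_top"
    using continuous_on_tendsto_compose[OF B wx] x by simp
  then have "((\<lambda>t. B (w t ** ?x ** w t) - C ?x) \<longlongrightarrow> B ?x - C ?x) at_top"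
    by (intro tendsto_intros)
  moreover have "\<forall>\<^sub>F t in at_top. B (w t ** ?x ** w t) - C ?x =
      D ((1 / t) *\<^sub>R (m ** y ** m)) - A ((1 / t) *\<^sub>R y)"
    using eventually_gt_at_top[of 0]
  proof eventually_elim
    case (elim t)
    show ?case
      using kummer_eqD[OF eq w(1,2)[OF elim] m] w(3)[OF elim]
      by (simp add: mm.scaleR_left mm.scaleR_right)
  qed
  ultimately show ?thesis by (rule Lim_transform_eventually)
qed

text \<open>Subtracting the limits for \<open>c *\<^sub>R s\<close> and
  \<open>c *\<^sub>R mat 1\<close>, both at \<open>y\<close> divided by the square of
  \<open>c\<close>, cancels \<open>A\<close>. The factor \<open>c\<close> is there because
  \<open>kummer_limit\<close> asks for matrices exceeding the identity.\<close>

lemma kummer_ratio_limit: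
  assumes eq: "kummer_eq A B C D" and B: "continuous_on posdef_cone B"
    and s: "s \<in> posdef_cone" and y: "y \<in> posdef_cone"
    and c: "1 < c" "c *\<^sub>R s - mat 1 \<in> posdef_cone"
    and F: "\<And>m. F m = B (m ** m - mat 1) - C (m ** m - mat 1)"
  shows "((\<lambda>t. D ((1 / t) *\<^sub>R (s ** y ** s)) - D ((1 / t) *\<^sub>R y)) \<longlongrightarrow>
    F (c *\<^sub>R s) - F (c *\<^sub>R mat 1)) at_top"
proof -
  let ?y = "(1 / c\<^sup>2) *\<^sub>R y"
  have y': "?y \<in> posdef_cone" using c y by auto
  have cs: "c *\<^sub>R s \<in> posdef_cone" "c *\<^sub>R mat 1 \<in> posdef_cone" using c s by auto
  have e: "(c *\<^sub>R s) ** ?y ** (c *\<^sub>R s) = s ** y ** s" "(c *\<^sub>R mat 1) ** ?y ** (c *\<^sub>R mat 1) = y"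
    using c by (simp_all add: mm.scaleR_left mm.scaleR_right power2_eq_square)
  have "((\<lambda>t. (D ((1 / t) *\<^sub>R (s ** y ** s)) - A ((1 / t) *\<^sub>R ?y)) - (D ((1 / t) *\<^sub>R y) - A ((1 / t) *\<^sub>R ?y)))
      \<longlongrightarrow> F (c *\<^sub>R s) - F (c *\<^sub>R mat 1)) at_top"
    using tendsto_diff[OF kummer_limit[OF eq B cs(1) c(2) y']
        kummer_limit[OF eq B cs(2) scaled_one_minus_one_posdef[OF c(1)] y']]
    unfolding e F .
  then show ?thesis by simp
qed

lemma exists_scale_above_one:
  assumes "s \<in> posdef_cone"
  obtains c where "1 < c" "c *\<^sub>R s - mat 1 \<in> posdef_cone"
proof -
  have "\<forall>\<^sub>F c in at_top. 1 < c \<and> c *\<^sub>R s - mat 1 \<in> posdef_cone"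
    by (intro eventually_conj eventually_gt_at_top posdef_scale_minus_eventually assms posdef_mat_1)
  then show ?thesis using that by (metis (no_types, lifting) eventually_at_top_linorder order_refl)
qed

lemma det_scaleR: "det (c *\<^sub>R (x :: real ^ 'n ^ 'n)) = c ^ CARD('n) * det x"
proof -
  have "c *\<^sub>R x = diagm (\<lambda>_. c) ** x" by (simp add: vec_eq_iff diagm_mul_nth)
  then show ?thesis by (simp add: det_mul)
qed

text \<open>The limiting increment \<open>G s\<close> of \<open>D\<close> under congruence by
  \<open>s\<close> is the same at every base point. Composing congruences therefore yields the
  quadratic equation solved by \<open>quadratic_log_equation\<close>.\<close>

lemma kummer_log_difference:
  fixes A B C D :: "real ^ 'n ^ 'n \<Rightarrow> real"
  assumes eq: "kummer_eq A B C D"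
    and B: "continuous_on posdef_cone B" and C: "continuous_on posdef_cone C"
  obtains a d where "\<And>x. x \<in> posdef_cone \<Longrightarrow> B x - C x = a * ln (det (mat 1 + x)) + d"
proof -
  define F where "F m = B (m ** m - mat 1) - C (m ** m - mat 1)" for m
  note lim = kummer_ratio_limit[OF eq B _ _ _ _ F_def]
  have "\<forall>s\<in>posdef_cone. \<exists>g. \<forall>y\<in>posdef_cone.
      ((\<lambda>t. D ((1 / t) *\<^sub>R (s ** y ** s)) - D ((1 / t) *\<^sub>R y)) \<longlongrightarrow> g) at_top"
  proof
    fix s :: "real ^ 'n ^ 'n" assume s: "s \<in> posdef_cone"
    obtain c where c: "1 < c" "c *\<^sub>R s - mat 1 \<in> posdef_cone"
      using exists_scale_above_one[OF s] by blast
    show "\<exists>g. \<forall>y\<in>posdef_cone.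
      ((\<lambda>t. D ((1 / t) *\<^sub>R (s ** y ** s)) - D ((1 / t) *\<^sub>R y)) \<longlongrightarrow> g) at_top"
      using lim[OF s _ c] by blast
  qed
  from bchoice[OF this] obtain G where G: "\<And>s y. s \<in> posdef_cone \<Longrightarrow> y \<in> posdef_cone \<Longrightarrow>
      ((\<lambda>t. D ((1 / t) *\<^sub>R (s ** y ** s)) - D ((1 / t) *\<^sub>R y)) \<longlongrightarrow> G s) at_top"
    by blast
  have GF: "G s = F (c *\<^sub>R s) - F (c *\<^sub>R mat 1)"
    if "s \<in> posdef_cone" "1 < c" "c *\<^sub>R s - mat 1 \<in> posdef_cone" for s c
    using tendsto_unique[OF _ G[OF that(1) posdef_mat_1] lim[OF that(1) posdef_mat_1 that(2,3)]] by simp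
  have "G (s ** t ** s) = 2 * G s + G t" if s: "s \<in> posdef_cone" and t: "t \<in> posdef_cone" for s t
  proof -
    \<comment> \<open>Passing from the identity to \<open>y2\<close>, \<open>y3\<close> and
      \<open>s ** y3 ** s\<close> applies \<open>s\<close>, \<open>t\<close> and \<open>s\<close> in
      turn; the single congruence by \<open>s ** t ** s\<close> has the same end point.\<close>
    define y2 where "y2 = s ** s"
    define y3 where "y3 = t ** y2 ** t"
    have y: "y2 \<in> posdef_cone" "y3 \<in> posdef_cone"
      using s t by (auto simp: y2_def y3_def intro: posdef_quad posdef_square)
    have e: "s ** t ** s ** mat 1 ** (s ** t ** s) = s ** y3 ** s" "s ** mat 1 ** s = y2"
      by (simp_all add: y2_def y3_def matrix_mul_assoc)
    let ?D = "\<lambda>y t. D ((1 / t) *\<^sub>R y)"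
    have "((\<lambda>r. (?D (s ** y3 ** s) r - ?D y3 r) + (?D y3 r - ?D y2 r) + (?D y2 r - ?D (mat 1) r))
        \<longlongrightarrow> G s + G t + G s) at_top"
      using G[OF s y(2)] G[OF t y(1)] G[OF s posdef_mat_1] unfolding e y3_def[symmetric]
      by (intro tendsto_add)
    moreover have "((\<lambda>r. ?D (s ** y3 ** s) r - ?D (mat 1) r) \<longlongrightarrow> G (s ** t ** s)) at_top"
      using G[OF posdef_quad[OF s t] posdef_mat_1] unfolding e .
    ultimately have "G s + G t + G s = G (s ** t ** s)"
      by (intro tendsto_unique[of at_top]) simp_all
    then show ?thesis by simp
  qed
  moreover have "continuous_on {1<..} (\<lambda>c. G (c *\<^sub>R mat 1))"
  proof -
    \<comment> \<open>By \<open>GF\<close> with factor 2, \<open>G\<close> at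
      \<open>c *\<^sub>R mat 1\<close> is expressed by \<open>B\<close> and \<open>C\<close> on
      scalar matrices, where continuity is available.\<close>
    have sq: "(2 * c) *\<^sub>R mat 1 ** (2 * c) *\<^sub>R mat 1 - mat 1 = (4 * c\<^sup>2 - 1) *\<^sub>R (mat 1 :: real ^ 'n ^ 'n)" for c :: real
      by (simp add: mm.scaleR_left mm.scaleR_right scaleR_diff_left power2_eq_square)
    have pos: "4 * c\<^sup>2 - 1 > 0" if "1 < c" for c :: real
      using one_less_power[OF that, of 2] by simp
    have comp: "continuous_on {1<..} (\<lambda>c. H ((4 * c\<^sup>2 - 1) *\<^sub>R mat 1))"
      if "continuous_on posdef_cone H" for H :: "real ^ 'n ^ 'n \<Rightarrow> real"
      by (rule continuous_on_compose2[OF that])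
        (auto intro!: continuous_intros posdef_scaleR pos)
    have 1: "continuous_on {1<..} (\<lambda>c. B ((4 * c\<^sup>2 - 1) *\<^sub>R mat 1) - C ((4 * c\<^sup>2 - 1) *\<^sub>R mat 1) - F (2 *\<^sub>R mat 1))"
      by (intro continuous_intros comp B C)
    have 2: "G (c *\<^sub>R mat 1) = B ((4 * c\<^sup>2 - 1) *\<^sub>R mat 1) - C ((4 * c\<^sup>2 - 1) *\<^sub>R mat 1) - F (2 *\<^sub>R mat 1)"
      if "1 < c" for c
      using GF[of "c *\<^sub>R mat 1" 2] that scaled_one_minus_one_posdef[of "2 * c"] sq[of c]
      by (simp add: F_def posdef_scaleR)
    show ?thesis by (rule continuous_on_eq[OF 1]) (simp add: 2)
  qed
  ultimately obtain \<kappa> where \<kappa>: "\<And>x. x \<in> posdef_cone \<Longrightarrow> G x = \<kappa> * ln (det x)"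
    using quadratic_log_equation[of G] by metis
  \<comment> \<open>With \<open>m\<close> the root of \<open>mat 1 + x\<close>, \<open>GF\<close>
    for half of \<open>m\<close> and factor 2 gives \<open>F m\<close>. Halving \<open>m\<close>
    costs the \<open>ln 2\<close> term, and \<open>det (mat 1 + x)\<close> is the square of
    \<open>det m\<close>, whence \<open>\<kappa> / 2\<close>.\<close>
  define d where "d = F (2 *\<^sub>R mat 1) - \<kappa> * real CARD('n) * ln 2"
  have "B x - C x = \<kappa> / 2 * ln (det (mat 1 + x)) + d" if x: "x \<in> posdef_cone" for x
  proof -
    define m where "m = msqrt (mat 1 + x)"
    have m: "m \<in> posdef_cone" "m - mat 1 \<in> posdef_cone" "m ** m = mat 1 + x"
      unfolding m_def by (rule one_plus_msqrt[OF x])+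
    have det_m: "det m > 0" by (rule det_posdef_pos[OF m(1)])
    have m2: "(1 / 2) *\<^sub>R m \<in> posdef_cone" using m(1) by (intro posdef_scaleR) auto
    have "ln (det (mat 1 + x)) = ln (det m * det m)" by (simp add: m(3)[symmetric] det_mul)
    then have 1: "ln (det (mat 1 + x)) = 2 * ln (det m)" using det_m by (simp add: ln_mult)
    have 2: "ln (det ((1 / 2) *\<^sub>R m)) = ln (det m) - real CARD('n) * ln 2"
      using det_m by (simp add: det_scaleR ln_mult ln_realpow ln_div power_divide)
    have "G ((1 / 2) *\<^sub>R m) = F m - F (2 *\<^sub>R mat 1)"
      using GF[OF m2, of 2] m(2) by simp
    then show ?thesis
      using \<kappa>[OF m2] 1 2 m(3) by (simp add: F_def d_def algebra_simps)
  qed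
  with that show ?thesis by blast
qed

section \<open>The reduced equation in two functions\<close>

lemma kummer_constant_zero:
  assumes eq: "kummer_eq p q q (\<lambda>x. p x + \<kappa>)" and q: "continuous_on posdef_cone q"
  shows "\<kappa> = 0"
proof -
  let ?e = "mat 1 :: real ^ 'a ^ 'a"
  have lim: "((\<lambda>t. p ((1 / t) *\<^sub>R ((c *\<^sub>R ?e) ** y ** (c *\<^sub>R ?e))) - p ((1 / t) *\<^sub>R y)) \<longlongrightarrow> - \<kappa>) at_top"
    if "1 < c" "y \<in> posdef_cone" for c y
  proof -
    have "c *\<^sub>R ?e \<in> posdef_cone" using that by (intro posdef_scaleR) auto
    from tendsto_diff[OF kummer_limit[OF eq q this scaled_one_minus_one_posdef[OF that(1)] that(2)]
        tendsto_const[of \<kappa>]]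
    show ?thesis by simp
  qed
  have 4: "4 *\<^sub>R ?e \<in> posdef_cone" by (intro posdef_scaleR) auto
  have "((\<lambda>t. (p ((1 / t) *\<^sub>R (16 *\<^sub>R ?e)) - p ((1 / t) *\<^sub>R (4 *\<^sub>R ?e))) +
      (p ((1 / t) *\<^sub>R (4 *\<^sub>R ?e)) - p ((1 / t) *\<^sub>R ?e))) \<longlongrightarrow> - \<kappa> + - \<kappa>) at_top"
    using lim[of 2 "4 *\<^sub>R ?e"] lim[of 2 ?e] 4 by (intro tendsto_add) (simp_all add: mm.scaleR_left mm.scaleR_right)
  moreover have "((\<lambda>t. p ((1 / t) *\<^sub>R (16 *\<^sub>R ?e)) - p ((1 / t) *\<^sub>R ?e)) \<longlongrightarrow> - \<kappa>) at_top"
    using lim[of 4 ?e] by (simp add: mm.scaleR_left mm.scaleR_right)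
  ultimately have "- \<kappa> + - \<kappa> = - \<kappa>" by (intro tendsto_unique[of at_top]) simp_all
  then show ?thesis by simp
qed

lemma kummer_pair_limit_zero:
  assumes eq: "kummer_eq p q q p" and q: "continuous_on posdef_cone q" and z: "z \<in> posdef_cone"
  shows "((\<lambda>t. p ((1 / t) *\<^sub>R z) - p ((1 / t) *\<^sub>R mat 1)) \<longlongrightarrow> 0) at_top"
proof -
  obtain s where s: "s \<in> posdef_cone" "s ** s = z" using posdef_sqrt_exists[OF z] by metis
  obtain c where "1 < c" "c *\<^sub>R s - mat 1 \<in> posdef_cone" using exists_scale_above_one[OF s(1)] by metis
  \<comment> \<open>Here \<open>B\<close> and \<open>C\<close> are both \<open>q\<close>, so the
    function \<open>F\<close> is identically zero.\<close>
  from kummer_ratio_limit[OF eq q s(1) posdef_mat_1 this refl] show ?thesis by (simp add: s(2))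
qed

text \<open>Take \<open>u = t *\<^sub>R mat 1\<close> and \<open>x = (1 / t) *\<^sub>R z\<close>,
  once for \<open>z\<close> and once for the identity. The terms
  \<open>p (t *\<^sub>R mat 1)\<close> cancel, and \<open>kummer_pair_limit_zero\<close> for the
  swapped pair removes the values of \<open>q\<close> near the origin.\<close>

lemma kummer_pair_limit:
  assumes eq: "kummer_eq p q q p" and p: "continuous_on posdef_cone p" and q: "continuous_on posdef_cone q"
    and z: "z \<in> posdef_cone"
  shows "((\<lambda>t. p (t *\<^sub>R mat 1 + z) - p (t *\<^sub>R mat 1 + mat 1)) \<longlongrightarrow> q z - q (mat 1)) at_top"
proof -
  have lim: "((\<lambda>t. q ((1 + t) *\<^sub>R ((1 / t) *\<^sub>R z))) \<longlongrightarrow> q z) at_top" if z: "z \<in> posdef_cone" for z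
  proof -
    have "((\<lambda>t. (1 / t + 1) *\<^sub>R z) \<longlongrightarrow> (0 + 1) *\<^sub>R z) at_top"
      by (intro tendsto_intros inverse_tendsto_0)
    moreover have "\<forall>\<^sub>F t in at_top. (1 / t + 1) *\<^sub>R z \<in> posdef_cone"
      using eventually_gt_at_top[of 0] by eventually_elim (auto intro!: posdef_scaleR z add_pos_pos)
    ultimately have "((\<lambda>t. q ((1 / t + 1) *\<^sub>R z)) \<longlongrightarrow> q z) at_top"
      using continuous_on_tendsto_compose[OF q, of "\<lambda>t. (1 / t + 1) *\<^sub>R z" z] z by simp
    moreover have "\<forall>\<^sub>F t in at_top. q ((1 / t + 1) *\<^sub>R z) = q ((1 + t) *\<^sub>R ((1 / t) *\<^sub>R z))"
      using eventually_gt_at_top[of 0] by eventually_elim (simp add: add_divide_distrib)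
    ultimately show ?thesis by (rule Lim_transform_eventually)
  qed
  have ex: "p (t *\<^sub>R mat 1 + z) = p (t *\<^sub>R mat 1) + q ((1 + t) *\<^sub>R ((1 / t) *\<^sub>R z)) - q ((1 / t) *\<^sub>R z)"
    if "0 < t" "z \<in> posdef_cone" for t z
    using kummer_eq_scalar[OF eq that(1), of "(1 / t) *\<^sub>R z"] that posdef_scaleR[OF that(2), of "1 / t"] by simp
  have "((\<lambda>t. q ((1 + t) *\<^sub>R ((1 / t) *\<^sub>R z)) - q ((1 + t) *\<^sub>R ((1 / t) *\<^sub>R mat 1)) -
      (q ((1 / t) *\<^sub>R z) - q ((1 / t) *\<^sub>R mat 1))) \<longlongrightarrow> q z - q (mat 1) - 0) at_top"
    by (intro tendsto_diff lim z posdef_mat_1 kummer_pair_limit_zero[OF kummer_eq_swap[OF eq] p])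
  then have "((\<lambda>t. q ((1 + t) *\<^sub>R ((1 / t) *\<^sub>R z)) - q ((1 + t) *\<^sub>R ((1 / t) *\<^sub>R mat 1)) -
      (q ((1 / t) *\<^sub>R z) - q ((1 / t) *\<^sub>R mat 1))) \<longlongrightarrow> q z - q (mat 1)) at_top"
    by (simp only: diff_zero)
  moreover have "\<forall>\<^sub>F t in at_top. q ((1 + t) *\<^sub>R ((1 / t) *\<^sub>R z)) - q ((1 + t) *\<^sub>R ((1 / t) *\<^sub>R mat 1)) -
      (q ((1 / t) *\<^sub>R z) - q ((1 / t) *\<^sub>R mat 1)) = p (t *\<^sub>R mat 1 + z) - p (t *\<^sub>R mat 1 + mat 1)"
    using eventually_gt_at_top[of 0]
  proof eventually_elim
    case (elim t)
    from ex[OF elim z] ex[OF elim posdef_mat_1] show ?case by linarith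
  qed
  ultimately show ?thesis by (rule Lim_transform_eventually)
qed

text \<open>Replacing \<open>t\<close> by \<open>t + h\<close> leaves the limit unchanged but
  translates \<open>z\<close> and the identity by \<open>h\<close>. So the increment of
  \<open>q\<close> is independent of \<open>z\<close>, hence additive in \<open>h\<close>, and
  continuity makes it linear.\<close>

lemma kummer_pair_translation:
  assumes eq: "kummer_eq p q q p" and p: "continuous_on posdef_cone p" and q: "continuous_on posdef_cone q"
  obtains \<rho> where "\<And>z h. z \<in> posdef_cone \<Longrightarrow> 0 < h \<Longrightarrow> q (z + h *\<^sub>R mat 1) = q z + \<rho> * h"
proof -
  note lim = kummer_pair_limit[OF eq p q]
  have tr: "q (z + h *\<^sub>R mat 1) - q (mat 1 + h *\<^sub>R mat 1) = q z - q (mat 1)"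
    if z: "z \<in> posdef_cone" and h: "0 < h" for z h
  proof -
    have "filterlim (\<lambda>t. t + h) at_top at_top"
      by (intro filterlim_tendsto_add_at_top[OF tendsto_const filterlim_ident, of h, simplified add.commute[of h]])
    from filterlim_compose[OF lim[OF z] this]
    have 1: "((\<lambda>t. p ((t + h) *\<^sub>R mat 1 + z) - p ((t + h) *\<^sub>R mat 1 + mat 1)) \<longlongrightarrow> q z - q (mat 1)) at_top" .
    have pd: "z + h *\<^sub>R mat 1 \<in> posdef_cone" "mat 1 + h *\<^sub>R mat 1 \<in> posdef_cone"
      using z h by (auto intro!: posdef_add posdef_scaleR)
    have "((\<lambda>t. p ((t + h) *\<^sub>R mat 1 + z) - p ((t + h) *\<^sub>R mat 1 + mat 1)) \<longlongrightarrow>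
        (q (z + h *\<^sub>R mat 1) - q (mat 1)) - (q (mat 1 + h *\<^sub>R mat 1) - q (mat 1))) at_top"
      using tendsto_diff[OF lim[OF pd(1)] lim[OF pd(2)]] by (simp add: scaleR_left_distrib algebra_simps)
    from tendsto_unique[OF _ this 1] show ?thesis by simp
  qed
  define \<psi> where "\<psi> h = q (mat 1 + h *\<^sub>R mat 1) - q (mat 1)" for h
  have "\<psi> (s + t) = \<psi> s + \<psi> t" if "0 < s" "0 < t" for s t
  proof -
    have "mat 1 + s *\<^sub>R mat 1 \<in> posdef_cone" using that by (intro posdef_add posdef_scaleR) auto
    from tr[OF this that(2)] show ?thesis
      by (simp add: \<psi>_def scaleR_left_distrib add.assoc)
  qed
  moreover have "continuous_on {0<..} \<psi>"
    unfolding \<psi>_def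
    by (intro continuous_intros continuous_on_compose2[OF q]) (auto intro!: posdef_add posdef_scaleR)
  ultimately have lin: "\<psi> h = h * \<psi> 1" if "0 < h" for h
    using additive_on_positive_linear that by blast
  have "q (z + h *\<^sub>R mat 1) = q z + \<psi> 1 * h" if "z \<in> posdef_cone" "0 < h" for z h
    using tr[OF that] lin[OF that(2)] unfolding \<psi>_def[of h] by (simp add: mult.commute)
  with that show ?thesis by blast
qed

text \<open>Everything aims at the hypotheses of \<open>tracial_zero\<close>: translation invariance
  gives homogeneity, and homogeneity allows the equation to be rescaled to its leading
  order.\<close>

theorem kummer_tracefree_zero:
  fixes \<phi> :: "real ^ 'n ^ 'n \<Rightarrow> real"
  assumes eq: "kummer_eq \<phi> \<phi> \<phi> \<phi>" and cont: "continuous_on posdef_cone \<phi>"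
    and tr: "\<And>z h. z \<in> posdef_cone \<Longrightarrow> 0 < h \<Longrightarrow> \<phi> (z + h *\<^sub>R mat 1) = \<phi> z"
    and one: "\<phi> (mat 1) = 0" and x: "x \<in> posdef_cone"
  shows "\<phi> x = 0"
proof -
  have scalar: "\<phi> (t *\<^sub>R mat 1) = 0" if t: "0 < t" for t
  proof (cases t "1 :: real" rule: linorder_cases)
    case less
    with tr[of "t *\<^sub>R mat 1" "1 - t"] t one show ?thesis
      by (simp add: posdef_scaleR scaleR_left_distrib[symmetric])
  next
    case greater
    with tr[of "mat 1" "t - 1"] one show ?thesis by (simp add: scaleR_diff_left)
  qed (simp add: one)
  \<comment> \<open>The scalar equation is used with parameter \<open>t / s\<close> at
    \<open>s *\<^sub>R x\<close>; translation invariance removes the scalar summand.\<close>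
  have add_scale: "\<phi> ((s + t) *\<^sub>R x) = \<phi> (s *\<^sub>R x) + \<phi> (t *\<^sub>R x)"
    if s: "0 < s" and t: "0 < t" and x: "x \<in> posdef_cone" for s t x
  proof -
    have ts: "0 < t / s" and sx: "s *\<^sub>R x \<in> posdef_cone" and tx: "t *\<^sub>R x \<in> posdef_cone"
      using s t x by auto
    have "\<phi> ((1 + t / s) *\<^sub>R s *\<^sub>R x) = \<phi> (s *\<^sub>R x) + \<phi> ((t / s) *\<^sub>R mat 1 + (t / s) *\<^sub>R s *\<^sub>R x)"
      using kummer_eq_scalar[OF eq ts sx] scalar[OF ts] by simp
    also have "(t / s) *\<^sub>R mat 1 + (t / s) *\<^sub>R s *\<^sub>R x = t *\<^sub>R x + (t / s) *\<^sub>R mat 1"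
      using s by simp
    also have "\<phi> \<dots> = \<phi> (t *\<^sub>R x)" by (rule tr[OF tx ts])
    also have "(1 + t / s) *\<^sub>R s *\<^sub>R x = (s + t) *\<^sub>R x" using s by (simp add: distrib_right)
    finally show ?thesis .
  qed
  have scale: "\<phi> (t *\<^sub>R x) = t * \<phi> x" if t: "0 < t" and x: "x \<in> posdef_cone" for t x
  proof -
    have "continuous_on {0<..} (\<lambda>t. \<phi> (t *\<^sub>R x))"
      by (rule continuous_on_compose2[OF cont]) (auto intro!: continuous_intros posdef_scaleR x)
    from additive_on_positive_linear[OF add_scale[OF _ _ x] this t] show ?thesis by simp
  qed
  have inv2: "((\<lambda>s :: real. (1 / s)\<^sup>2) \<longlongrightarrow> 0) at_top"
    using tendsto_power[OF inverse_tendsto_0, of 2] by simp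
  have lim: "((\<lambda>s. \<phi> (a ** (b - (1 / s)\<^sup>2 *\<^sub>R mat 1) ** a)) \<longlongrightarrow> \<phi> (a ** b ** a)) at_top"
    if "a ** b ** a \<in> posdef_cone" "\<forall>\<^sub>F s in at_top. a ** (b - (1 / s)\<^sup>2 *\<^sub>R mat 1) ** a \<in> posdef_cone" for a b
  proof -
    have "((\<lambda>s. a ** (b - (1 / s)\<^sup>2 *\<^sub>R mat 1) ** a) \<longlongrightarrow> a ** (b - 0 *\<^sub>R mat 1) ** a) at_top"
      by (intro mm.tendsto tendsto_intros inv2)
    then show ?thesis using continuous_on_tendsto_compose[OF cont _ that] by simp
  qed
  have ev: "\<forall>\<^sub>F s in at_top. 1 < s \<and> s *\<^sub>R w - mat 1 \<in> posdef_cone" if "w \<in> posdef_cone" for w :: "real ^ 'n ^ 'n"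
    by (intro eventually_conj eventually_gt_at_top posdef_scale_minus_eventually that posdef_mat_1)
  have sq: "(s *\<^sub>R w) ** (s *\<^sub>R w) - mat 1 = s\<^sup>2 *\<^sub>R (w ** w - (1 / s)\<^sup>2 *\<^sub>R mat 1)" if "1 < s" for s and w :: "real ^ 'n ^ 'n"
    using that by (simp add: mm.scaleR_left mm.scaleR_right scaleR_diff_right power2_eq_square)
  have sqpd: "w ** w - (1 / s)\<^sup>2 *\<^sub>R mat 1 \<in> posdef_cone"
    if "1 < s" "w \<in> posdef_cone" "s *\<^sub>R w - mat 1 \<in> posdef_cone" for s and w :: "real ^ 'n ^ 'n"
  proof -
    have "s *\<^sub>R w \<in> posdef_cone" using that by (intro posdef_scaleR) auto
    from posdef_square_minus_one[OF this that(3)]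
    have "s\<^sup>2 *\<^sub>R (w ** w - (1 / s)\<^sup>2 *\<^sub>R mat 1) \<in> posdef_cone"
      unfolding sq[OF that(1)] .
    then have "(1 / s)\<^sup>2 *\<^sub>R (s\<^sup>2 *\<^sub>R (w ** w - (1 / s)\<^sup>2 *\<^sub>R mat 1)) \<in> posdef_cone"
      by (rule posdef_scaleR) (use that(1) in simp)
    moreover have "(1 / s)\<^sup>2 * s\<^sup>2 = 1" using that(1) by (simp add: power_divide)
    ultimately show ?thesis by (simp only: scaleR_scaleR scaleR_one)
  qed
  \<comment> \<open>Put \<open>s *\<^sub>R w\<close> for \<open>w\<close> in the equation, divide by
    the square of \<open>s\<close> and let \<open>s\<close> grow: the term
    \<open>\<phi> (m ** m - mat 1)\<close> disappears.\<close>
  have key1: "\<phi> (m ** (w ** w) ** m) = \<phi> (w ** w) + \<phi> (w ** (m ** m - mat 1) ** w)"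
    if w: "w \<in> posdef_cone" and m: "m \<in> posdef_cone" "m - mat 1 \<in> posdef_cone" for w m
  proof -
    have x: "m ** m - mat 1 \<in> posdef_cone" by (rule posdef_square_minus_one[OF m])
    define v where "v s = w ** w - (1 / s)\<^sup>2 *\<^sub>R mat 1" for s
    have e: "\<forall>\<^sub>F s in at_top. \<phi> (mat 1 ** v s ** mat 1) + \<phi> (w ** (m ** m - mat 1) ** w) - (1 / s)\<^sup>2 * \<phi> (m ** m - mat 1)
        = \<phi> (m ** v s ** m)"
      using ev[OF w]
    proof eventually_elim
      case (elim s)
      have s: "s > 1" and sw: "s *\<^sub>R w \<in> posdef_cone" using elim w by (auto intro!: posdef_scaleR)
      have v: "v s \<in> posdef_cone" unfolding v_def using elim w by (intro sqpd) auto
      have "\<phi> (s\<^sup>2 *\<^sub>R v s) + \<phi> (s\<^sup>2 *\<^sub>R (w ** (m ** m - mat 1) ** w)) = \<phi> (m ** m - mat 1) + \<phi> (s\<^sup>2 *\<^sub>R (m ** v s ** m))"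
        using kummer_eqD[OF eq sw _ m] elim unfolding sq[OF s] v_def[symmetric]
        by (simp add: mm.scaleR_left mm.scaleR_right power2_eq_square)
      then have "s\<^sup>2 * \<phi> (v s) + s\<^sup>2 * \<phi> (w ** (m ** m - mat 1) ** w) = \<phi> (m ** m - mat 1) + s\<^sup>2 * \<phi> (m ** v s ** m)"
        using s v posdef_quad[OF w x] posdef_quad[OF m(1) v] by (simp add: scale)
      then show ?case using s by (simp add: field_simps)
    qed
    have evpd: "\<forall>\<^sub>F s in at_top. a ** v s ** a \<in> posdef_cone" if "a \<in> posdef_cone" for a
      using ev[OF w] unfolding v_def by eventually_elim (auto intro!: posdef_quad sqpd that w)
    have l1: "((\<lambda>s. \<phi> (a ** v s ** a)) \<longlongrightarrow> \<phi> (a ** (w ** w) ** a)) at_top" if "a \<in> posdef_cone" for a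
      unfolding v_def
      by (rule lim) (use evpd[OF that] posdef_quad[OF that posdef_square[OF w]] in \<open>simp_all add: v_def\<close>)
    have "((\<lambda>s. \<phi> (mat 1 ** v s ** mat 1) + \<phi> (w ** (m ** m - mat 1) ** w) - (1 / s)\<^sup>2 * \<phi> (m ** m - mat 1)) \<longlongrightarrow>
        \<phi> (mat 1 ** (w ** w) ** mat 1) + \<phi> (w ** (m ** m - mat 1) ** w) - 0 * \<phi> (m ** m - mat 1)) at_top"
      by (intro tendsto_intros l1 inv2 posdef_mat_1)
    from tendsto_unique[OF _ Lim_transform_eventually[OF this e] l1[OF m(1)]] show ?thesis by simp
  qed
  \<comment> \<open>The same rescaling of \<open>m\<close> in \<open>key1\<close> removes the term
    \<open>\<phi> (w ** w)\<close>.\<close>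
  have key2: "\<phi> (m ** (w ** w) ** m) = \<phi> (w ** (m ** m) ** w)"
    if w: "w \<in> posdef_cone" and m: "m \<in> posdef_cone" for w m
  proof -
    define v where "v s = m ** m - (1 / s)\<^sup>2 *\<^sub>R mat 1" for s
    have e: "\<forall>\<^sub>F s in at_top. \<phi> (m ** (w ** w) ** m) - (1 / s)\<^sup>2 * \<phi> (w ** w) = \<phi> (w ** v s ** w)"
      using ev[OF m]
    proof eventually_elim
      case (elim s)
      have s: "s > 1" and sm: "s *\<^sub>R m \<in> posdef_cone" using elim m by (auto intro!: posdef_scaleR)
      have v: "v s \<in> posdef_cone" unfolding v_def using elim m by (intro sqpd) auto
      have "\<phi> (s\<^sup>2 *\<^sub>R (m ** (w ** w) ** m)) = \<phi> (w ** w) + \<phi> (s\<^sup>2 *\<^sub>R (w ** v s ** w))"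
        using key1[OF w sm] elim unfolding sq[OF s] v_def[symmetric]
        by (simp add: mm.scaleR_left mm.scaleR_right power2_eq_square)
      then have "s\<^sup>2 * \<phi> (m ** (w ** w) ** m) = \<phi> (w ** w) + s\<^sup>2 * \<phi> (w ** v s ** w)"
        using s posdef_quad[OF w v] posdef_quad[OF m posdef_square[OF w]] by (simp add: scale)
      then show ?case using s by (simp add: field_simps)
    qed
    have evpd: "\<forall>\<^sub>F s in at_top. w ** v s ** w \<in> posdef_cone"
      using ev[OF m] unfolding v_def by eventually_elim (auto intro!: posdef_quad sqpd m w)
    have l1: "((\<lambda>s. \<phi> (w ** v s ** w)) \<longlongrightarrow> \<phi> (w ** (m ** m) ** w)) at_top"
      unfolding v_def
      by (rule lim) (use evpd posdef_quad[OF w posdef_square[OF m]] in \<open>simp_all add: v_def\<close>)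
    have "((\<lambda>s. \<phi> (m ** (w ** w) ** m) - (1 / s)\<^sup>2 * \<phi> (w ** w)) \<longlongrightarrow> \<phi> (m ** (w ** w) ** m) - 0 * \<phi> (w ** w)) at_top"
      by (intro tendsto_intros inv2)
    from tendsto_unique[OF _ Lim_transform_eventually[OF this e] l1] show ?thesis by simp
  qed
  \<comment> \<open>Choose \<open>w\<close> and \<open>m\<close> with \<open>w ** w = x\<close> and
    \<open>w ** (m ** m) ** w = x + y\<close>; \<open>key2\<close> turns the left side of
    \<open>key1\<close> into \<phi> at this sum.\<close>
  have add: "\<phi> (x + y) = \<phi> x + \<phi> y" if x: "x \<in> posdef_cone" and y: "y \<in> posdef_cone" for x y
  proof -
    obtain w where w: "w \<in> posdef_cone" "w ** w = x" using posdef_sqrt_exists[OF x] by metis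
    define i where "i = matrix_inv w"
    have i: "i \<in> posdef_cone" "w ** i = mat 1" "i ** w = mat 1"
      using posdef_inv[OF w(1)] matrix_inv_inverse[OF posdef_invertible[OF w(1)]] by (simp_all add: i_def)
    define u where "u = i ** y ** i"
    have u: "u \<in> posdef_cone" unfolding u_def by (rule posdef_quad[OF i(1) y])
    have "w ** u ** w = (w ** i) ** y ** (i ** w)" unfolding u_def by (simp only: matrix_mul_assoc)
    then have wuw: "w ** u ** w = y" by (simp add: i)
    let ?m = "msqrt (mat 1 + u)"
    note m = one_plus_msqrt[OF u]
    have "\<phi> (w ** (?m ** ?m) ** w) = \<phi> (w ** w) + \<phi> (w ** (?m ** ?m - mat 1) ** w)"
      using key1[OF w(1) m(1,2)] key2[OF w(1) m(1)] by simp
    then show ?thesis unfolding m(3) by (simp add: mm.add_left mm.add_right wuw w(2))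
  qed
  show ?thesis
    by (rule tracial_zero[of \<phi>]) (use add scale key2 one x in simp_all)
qed

lemma kummer_pair_trace:
  fixes p q :: "real ^ 'n ^ 'n \<Rightarrow> real"
  assumes eq: "kummer_eq p q q p" and p: "continuous_on posdef_cone p" and q: "continuous_on posdef_cone q"
  obtains \<tau> \<alpha> \<beta> where "\<And>x. x \<in> posdef_cone \<Longrightarrow> p x = \<tau> * trace x + \<alpha>"
    "\<And>x. x \<in> posdef_cone \<Longrightarrow> q x = \<tau> * trace x + \<beta>"
proof -
  obtain \<rho> where \<rho>: "\<And>z h. z \<in> posdef_cone \<Longrightarrow> 0 < h \<Longrightarrow> q (z + h *\<^sub>R mat 1) = q z + \<rho> * h"
    using kummer_pair_translation[OF eq p q] by blast
  obtain \<rho>' where \<rho>': "\<And>z h. z \<in> posdef_cone \<Longrightarrow> 0 < h \<Longrightarrow> p (z + h *\<^sub>R mat 1) = p z + \<rho>' * h"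
    using kummer_pair_translation[OF kummer_eq_swap[OF eq] q p] by blast
  have pq: "p z - p (mat 1) = q z - q (mat 1)" if z: "z \<in> posdef_cone" for z
  proof -
    \<comment> \<open>By translation this difference is constant in \<open>t\<close>, so it equals
      the limit from \<open>kummer_pair_limit\<close>.\<close>
    have "\<forall>\<^sub>F t in at_top. p (t *\<^sub>R mat 1 + z) - p (t *\<^sub>R mat 1 + mat 1) = p z - p (mat 1)"
      using eventually_gt_at_top[of 0]
    proof eventually_elim
      case (elim t)
      show ?case
        using \<rho>'[OF z elim] \<rho>'[OF posdef_mat_1 elim] by (simp add: add.commute)
    qed
    from tendsto_unique[OF _ tendsto_eventually[OF this] kummer_pair_limit[OF eq p q z]]
    show ?thesis by simp
  qed
  define N where "N = real CARD('n)"
  have N: "N > 0" by (simp add: N_def)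
  \<comment> \<open>The trace grows by \<open>N * h\<close> under translation by
    \<open>h *\<^sub>R mat 1\<close>, so this multiple cancels the slope \<rho>; the constant in
    \<phi> makes it vanish at the identity.\<close>
  define \<tau> where "\<tau> = \<rho> / N"
  define \<phi> where "\<phi> x = q x - \<tau> * trace x - (q (mat 1) - \<rho>)" for x
  have tr1: "trace (mat 1 :: real ^ 'n ^ 'n) = N" by (simp add: N_def trace_I)
  have tr_scale: "trace (c *\<^sub>R x) = c * trace x" for c and x :: "real ^ 'n ^ 'n"
    by (simp add: trace_def sum_distrib_left)
  have q_eq: "q x = \<phi> x + \<tau> * trace x + (q (mat 1) - \<rho>)" for x
    by (simp add: \<phi>_def)
  have p_eq: "p x = \<phi> x + \<tau> * trace x + (p (mat 1) - \<rho>)" if "x \<in> posdef_cone" for x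
    using pq[OF that] by (simp add: \<phi>_def)
  have eq\<phi>: "kummer_eq \<phi> \<phi> \<phi> \<phi>"
    unfolding kummer_eq_def
  proof (intro allI impI)
    fix w m :: "real ^ 'n ^ 'n"
    assume w: "w \<in> posdef_cone" "w - mat 1 \<in> posdef_cone"
      and m: "m \<in> posdef_cone" "m - mat 1 \<in> posdef_cone"
    note wx = posdef_square_minus_one[OF w] and mx = posdef_square_minus_one[OF m]
    \<comment> \<open>By cyclicity the trace itself solves the equation, so subtracting a multiple
      of it preserves the equation.\<close>
    have "trace (w ** (m ** m) ** w) = trace (m ** (w ** w) ** m)"
      using trace_mul_sym[of "w ** m" "m ** w"] by (simp add: matrix_mul_assoc)
    then have "trace (w ** w - mat 1) + trace (w ** (m ** m - mat 1) ** w) =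
        trace (m ** m - mat 1) + trace (m ** (w ** w - mat 1) ** m)"
      by (simp add: mm.diff_left mm.diff_right trace_sub)
    then have "\<tau> * trace (w ** w - mat 1) + \<tau> * trace (w ** (m ** m - mat 1) ** w) =
        \<tau> * trace (m ** m - mat 1) + \<tau> * trace (m ** (w ** w - mat 1) ** m)"
      by (simp only: distrib_left[symmetric])
    then show "\<phi> (w ** w - mat 1) + \<phi> (w ** (m ** m - mat 1) ** w) =
        \<phi> (m ** m - mat 1) + \<phi> (m ** (w ** w - mat 1) ** m)"
      using kummer_eqD[OF eq w m] p_eq[OF wx] p_eq[OF posdef_quad[OF m(1) wx]]
        q_eq[of "m ** m - mat 1"] q_eq[of "w ** (m ** m - mat 1) ** w"]
      by linarith
  qed
  have cont: "continuous_on posdef_cone \<phi>"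
    unfolding \<phi>_def trace_def by (intro continuous_intros q)
  have tr: "\<phi> (z + h *\<^sub>R mat 1) = \<phi> z" if "z \<in> posdef_cone" "0 < h" for z h
    using \<rho>[OF that] N by (simp add: \<phi>_def trace_add tr_scale tr1 \<tau>_def distrib_left)
  have one: "\<phi> (mat 1) = 0" using N by (simp add: \<phi>_def tr1 \<tau>_def)
  have zero: "\<phi> x = 0" if "x \<in> posdef_cone" for x
    by (rule kummer_tracefree_zero[OF eq\<phi> cont tr one that])
  show thesis
  proof
    show "p x = \<tau> * trace x + (p (mat 1) - \<rho>)" if "x \<in> posdef_cone" for x
      using p_eq[OF that] zero[OF that] by simp
    show "q x = \<tau> * trace x + (q (mat 1) - \<rho>)" if "x \<in> posdef_cone" for x
      using q_eq[of x] zero[OF that] by simp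
  qed
qed

section \<open>Removing the logarithmic terms and assembling the solution\<close>

lemma continuous_on_ln_det: "continuous_on posdef_cone (\<lambda>x :: real ^ 'n ^ 'n. ln (det x))"
proof -
  have "continuous_on posdef_cone (\<lambda>x :: real ^ 'n ^ 'n. det x)"
    unfolding det_def by (intro continuous_intros)
  then show ?thesis
    by (rule continuous_on_ln) (use det_posdef_pos in force)
qed

lemma continuous_on_ln_det_one_plus:
  "continuous_on posdef_cone (\<lambda>x :: real ^ 'n ^ 'n. ln (det (mat 1 + x)))"
  by (rule continuous_on_compose2[OF continuous_on_ln_det])
    (auto intro!: continuous_intros)

lemma ln_det_quad:
  assumes "w \<in> posdef_cone" "x \<in> posdef_cone"
  shows "ln (det (w ** x ** w)) = ln (det (w ** w)) + ln (det x)"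
  using det_posdef_pos[OF assms(1)] det_posdef_pos[OF assms(2)]
  by (simp add: det_mul ln_mult)

theorem kummer_eq_solution:
  fixes A B C D :: "real ^ 'n ^ 'n \<Rightarrow> real"
  assumes eq: "kummer_eq A B C D"
    and A: "continuous_on posdef_cone A" and B: "continuous_on posdef_cone B"
    and C: "continuous_on posdef_cone C" and D: "continuous_on posdef_cone D"
  shows "\<exists>a b c1 c2 d lam :: real. \<forall>x \<in> posdef_cone.
      A x = a * ln (det x) - b * ln (det (mat 1 + x)) + c1 + lam * trace x \<and>
      B x = b * ln (det x) + c2 + d + lam * trace x \<and>
      C x = b * ln (det x) - a * ln (det (mat 1 + x)) + c2 + lam * trace x \<and>
      D x = a * ln (det x) + c1 + d + lam * trace x"
proof -
  obtain a d where BC: "\<And>x. x \<in> posdef_cone \<Longrightarrow> B x - C x = a * ln (det (mat 1 + x)) + d"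
    using kummer_log_difference[OF eq B C] by metis
  obtain b d' where DA: "\<And>x. x \<in> posdef_cone \<Longrightarrow> D x - A x = b * ln (det (mat 1 + x)) + d'"
    using kummer_log_difference[OF kummer_eq_swap[OF eq] D A] by metis
  \<comment> \<open>By \<open>BC\<close> and \<open>DA\<close>, on the cone \<open>B x\<close> is
    \<open>q x + b * ln (det x) + d\<close> and \<open>D x\<close> is
    \<open>p x + a * ln (det x) + d'\<close>. Multiplicativity of the determinant then cancels all
    logarithms in the equation.\<close>
  define p where "p x = A x - a * ln (det x) + b * ln (det (mat 1 + x))" for x
  define q where "q x = C x - b * ln (det x) + a * ln (det (mat 1 + x))" for x
  have p: "continuous_on posdef_cone p" and q: "continuous_on posdef_cone q"
    unfolding p_def q_def
    by (intro continuous_intros A C continuous_on_ln_det continuous_on_ln_det_one_plus)+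
  have eq': "kummer_eq p q q (\<lambda>x. p x + (d' - d))"
    unfolding kummer_eq_def
  proof (intro allI impI)
    fix w m :: "real ^ 'n ^ 'n"
    assume w: "w \<in> posdef_cone" "w - mat 1 \<in> posdef_cone"
      and m: "m \<in> posdef_cone" "m - mat 1 \<in> posdef_cone"
    define u where "u = w ** w - mat 1"
    define x where "x = m ** m - mat 1"
    have ux: "u \<in> posdef_cone" "x \<in> posdef_cone"
      using posdef_square_minus_one w m by (auto simp: u_def x_def)
    have sq: "mat 1 + u = w ** w" "mat 1 + x = m ** m" by (simp_all add: u_def x_def)
    have wx: "w ** x ** w \<in> posdef_cone" and mu: "m ** u ** m \<in> posdef_cone"
      using posdef_quad w m ux by auto
    have "p u + q (w ** x ** w) = q x + (p (m ** u ** m) + (d' - d))"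
      using kummer_eqD[OF eq w m, folded u_def x_def] BC[OF wx] DA[OF mu]
      unfolding p_def q_def sq ln_det_quad[OF w(1) ux(2)] ln_det_quad[OF m(1) ux(1)]
      by (simp add: distrib_left)
    then show "p (w ** w - mat 1) + q (w ** (m ** m - mat 1) ** w) =
        q (m ** m - mat 1) + (p (m ** (w ** w - mat 1) ** m) + (d' - d))"
      by (simp only: u_def x_def)
  qed
  have d: "d' = d" using kummer_constant_zero[OF eq' q] by simp
  have "kummer_eq p q q p" using eq' by (simp add: d)
  then obtain \<tau> \<alpha> \<beta> where "\<And>x. x \<in> posdef_cone \<Longrightarrow> p x = \<tau> * trace x + \<alpha>"
    "\<And>x. x \<in> posdef_cone \<Longrightarrow> q x = \<tau> * trace x + \<beta>"
    using kummer_pair_trace[OF _ p q] by metis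
  then have "A x = a * ln (det x) - b * ln (det (mat 1 + x)) + \<alpha> + \<tau> * trace x \<and>
      B x = b * ln (det x) + \<beta> + d + \<tau> * trace x \<and>
      C x = b * ln (det x) - a * ln (det (mat 1 + x)) + \<beta> + \<tau> * trace x \<and>
      D x = a * ln (det x) + \<alpha> + d + \<tau> * trace x" if "x \<in> posdef_cone" for x
    using BC[OF that] DA[OF that] that by (simp add: p_def q_def d algebra_simps)
  then show ?thesis by blast
qed

theorem proposition4p6:
  fixes A B C D :: "real ^ 'n ^ 'n \<Rightarrow> real"
  assumes "continuous_on posdef_cone A"
    and "continuous_on posdef_cone B"
    and "continuous_on posdef_cone C"
    and "continuous_on posdef_cone D"
    and "\<And>u v. u \<in> posdef_cone \<Longrightarrow> v \<in> posdef_cone \<Longrightarrow>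
      A u + B v =
        C (quad_rep (matrix_inv (msqrt (mat 1 + u))) v) +
        D (quad_rep (msqrt (mat 1 + quad_rep (matrix_inv (msqrt (mat 1 + u))) v)) u)"
  shows "\<exists>a b c1 c2 d lam :: real. \<forall>x \<in> posdef_cone.
      A x = a * ln (det x) - b * ln (det (mat 1 + x)) + c1 + lam * trace x \<and>
      B x = b * ln (det x) + c2 + d + lam * trace x \<and>
      C x = b * ln (det x) - a * ln (det (mat 1 + x)) + c2 + lam * trace x \<and>
      D x = a * ln (det x) + c1 + d + lam * trace x"
proof (rule kummer_eq_solution[OF _ assms(1-4)])
  show "kummer_eq A B C D"
    unfolding kummer_eq_def
  proof (intro allI impI)
    fix w m :: "real ^ 'n ^ 'n"
    assume w: "w \<in> posdef_cone" "w - mat 1 \<in> posdef_cone"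
      and m: "m \<in> posdef_cone" "m - mat 1 \<in> posdef_cone"
    \<comment> \<open>The hypothesis is applied with \<open>v = w ** x ** w\<close>: the root of
      \<open>mat 1 + u\<close> is \<open>w\<close>, so the argument of \<open>C\<close> becomes
      \<open>x\<close> and the outer root in the argument of \<open>D\<close> becomes
      \<open>m\<close>.\<close>
    define u where "u = w ** w - mat 1"
    define x where "x = m ** m - mat 1"
    have ux: "u \<in> posdef_cone" "x \<in> posdef_cone"
      using posdef_square_minus_one w m by (auto simp: u_def x_def)
    have roots: "msqrt (mat 1 + u) = w" "msqrt (mat 1 + x) = m"
      using w m by (auto intro!: msqrt_eqI simp: u_def x_def)
    note inv = matrix_inv_inverse[OF posdef_invertible[OF w(1)]]
    have "matrix_inv w ** (w ** x ** w) ** matrix_inv w = (matrix_inv w ** w) ** x ** (w ** matrix_inv w)"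
      by (simp only: matrix_mul_assoc)
    then have cancel: "quad_rep (matrix_inv w) (w ** x ** w) = x"
      by (simp add: quad_rep_def inv)
    have "A u + B (w ** x ** w) = C x + D (m ** u ** m)"
      using assms(5)[OF ux(1) posdef_quad[OF w(1) ux(2)]] unfolding roots cancel unfolding roots quad_rep_def .
    then show "A (w ** w - mat 1) + B (w ** (m ** m - mat 1) ** w) =
        C (m ** m - mat 1) + D (m ** (w ** w - mat 1) ** m)"
      by (simp only: u_def x_def)
  qed
qed

end
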